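(* Let $p:E\rightarrow B$ be a definable Serre fibration, let $b_0\in B$, $F=p^{-1}(b_0)$ and $e_0\in F$. Then the induced map $p_*:\pi_n(E,F,e_0)^{\mathcal R}\rightarrow \pi_n(B,b_0)^{\mathcal R}$ is a bijection for $n=1$ and a group isomorphism for all $n\geq 2$.
   Context: Throughout, $\mathcal R$ is a fixed o-minimal expansion of a real closed field $R$; "definable" means definable in $\mathcal R$ with parameters; all maps are continuous; $I=[0,1]\subseteq R$. A definable continuous map $p:E\to B$ is a definable Serre fibration if for every closed and bounded definable set $X$, every definable homotopy $H:X\times I\to B$ and every definable map $\widetilde f:X\to E$ with $p\circ\widetilde f=H(\cdot,0)$, there is a definable homotopy $\widetilde H:X\times I\to E$ with $p\circ\widetilde H=H$ and $\widetilde H(\cdot,0)=\widetilde f$. For a definable pointed pair $(X,A,x_0)$ ($x_0\in A\subseteq X$) and $n\ge1$, $\pi_n(X,A,x_0)^{\mathcal R}$ is the set of definable continuous maps $f:I^n\to X$ with $f(I^{n-1})\subseteq A$ and $f(J^{n-1})=\{x_0\}$, modulo definable homotopies with the same properties at each time, where $I^{n-1}=\{t\in I^n:t_n=0\}$ and $J^{n-1}=\overline{\partial I^n\setminus I^{n-1}}$; it is a group for $n\ge2$. $\pi_n(B,b_0)^{\mathcal R}$ is the absolute homotopy group (maps $(I^n,\partial I^n)\to(B,b_0)$ modulo definable homotopy), and $p_*$ is induced by $p:(E,F,e_0)\to(B,b_0,b_0)$ via $[f]\mapsto[p\circ f]$. *)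

theory Defs
  imports
    "HOL-Analysis.Analysis"
    "HOL-Computational_Algebra.Polynomial"
    "HOL-Algebra.Group"
begin

definition real_closed_field :: "'a::linordered_field itself \<Rightarrow> bool" where
  "real_closed_field _ \<longleftrightarrow>
     (\<forall>a::'a. 0 \<le> a \<longrightarrow> (\<exists>b. b * b = a)) \<and>
     (\<forall>q::'a poly. odd (degree q) \<longrightarrow> (\<exists>x. poly q x = 0))"

text \<open>
  The symbols of the language of ordered rings are built into terms and formulas; an expansion
  interprets additional function symbols and relation symbols. A symbol together with the length
  of its argument list plays the role of a symbol of fixed arity. \<open>Const\<close> supplies the parameters.
\<close>

record ('a, 'f, 'r) expansion =
  fun_interp :: "'f \<Rightarrow> 'a list \<Rightarrow> 'a"
  rel_interp :: "'r \<Rightarrow> 'a list \<Rightarrow> bool"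

datatype ('a, 'f) fo_term =
    Var nat
  | Const 'a
  | Plus "('a, 'f) fo_term" "('a, 'f) fo_term"
  | Minus "('a, 'f) fo_term"
  | Times "('a, 'f) fo_term" "('a, 'f) fo_term"
  | Fn 'f "('a, 'f) fo_term list"

datatype ('a, 'f, 'r) fo_formula =
    Equal "('a, 'f) fo_term" "('a, 'f) fo_term"
  | Less "('a, 'f) fo_term" "('a, 'f) fo_term"
  | Rel 'r "('a, 'f) fo_term list"
  | Neg "('a, 'f, 'r) fo_formula"
  | Conj "('a, 'f, 'r) fo_formula" "('a, 'f, 'r) fo_formula"
  | Exists nat "('a, 'f, 'r) fo_formula"

primrec eval_term ::
  "('a::linordered_field, 'f, 'r) expansion \<Rightarrow> (nat \<Rightarrow> 'a) \<Rightarrow> ('a, 'f) fo_term \<Rightarrow> 'a" where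
  "eval_term R v (Var i) = v i"
| "eval_term R v (Const a) = a"
| "eval_term R v (Plus s t) = eval_term R v s + eval_term R v t"
| "eval_term R v (Minus s) = - eval_term R v s"
| "eval_term R v (Times s t) = eval_term R v s * eval_term R v t"
| "eval_term R v (Fn f ts) = fun_interp R f (map (eval_term R v) ts)"

primrec satisfies ::
  "('a::linordered_field, 'f, 'r) expansion \<Rightarrow> (nat \<Rightarrow> 'a) \<Rightarrow> ('a, 'f, 'r) fo_formula \<Rightarrow> bool" where
  "satisfies R v (Equal s t) \<longleftrightarrow> eval_term R v s = eval_term R v t"
| "satisfies R v (Less s t) \<longleftrightarrow> eval_term R v s < eval_term R v t"
| "satisfies R v (Rel r ts) \<longleftrightarrow> rel_interp R r (map (eval_term R v) ts)"
| "satisfies R v (Neg \<phi>) \<longleftrightarrow> \<not> satisfies R v \<phi>"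
| "satisfies R v (Conj \<phi> \<psi>) \<longleftrightarrow> satisfies R v \<phi> \<and> satisfies R v \<psi>"
| "satisfies R v (Exists i \<phi>) \<longleftrightarrow> (\<exists>a. satisfies R (v(i := a)) \<phi>)"

text \<open>
  A point of \<open>R\<^sup>n\<close> is a list of length \<open>n\<close>. Variables with index \<open>\<ge> n\<close> are assigned 0; since
  0 is a parameter anyway, free occurrences of such variables define nothing new.
\<close>

definition assignment :: "'a::zero list \<Rightarrow> nat \<Rightarrow> 'a" where
  "assignment x i = (if i < length x then x ! i else 0)"

definition definable ::
  "('a::linordered_field, 'f, 'r) expansion \<Rightarrow> nat \<Rightarrow> 'a list set \<Rightarrow> bool" where
  "definable R n S \<longleftrightarrow> (\<exists>\<phi>. S = {x. length x = n \<and> satisfies R (assignment x) \<phi>})"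

definition point_or_open_interval :: "'a::linorder set \<Rightarrow> bool" where
  "point_or_open_interval J \<longleftrightarrow>
     (\<exists>a. J = {a}) \<or> (\<exists>a b. J = {a<..<b}) \<or> (\<exists>a. J = {a<..}) \<or> (\<exists>b. J = {..<b}) \<or> J = UNIV"

definition o_minimal :: "('a::linordered_field, 'f, 'r) expansion \<Rightarrow> bool" where
  "o_minimal R \<longleftrightarrow>
     (\<forall>S. definable R 1 S \<longrightarrow>
        (\<exists>\<J>. finite \<J> \<and> (\<forall>J\<in>\<J>. point_or_open_interval J) \<and> {a. [a] \<in> S} = \<Union>\<J>))"

definition open_box :: "'a::linorder list \<Rightarrow> 'a list \<Rightarrow> 'a list set" where
  "open_box a b = {x. length x = length a \<and> (\<forall>i<length a. a ! i < x ! i \<and> x ! i < b ! i)}"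

definition Rn :: "nat \<Rightarrow> 'a::linordered_field list topology" where
  "Rn n = topology_generated_by {open_box a b |a b. length a = n \<and> length b = n}"

definition definable_map ::
  "('a::linordered_field, 'f, 'r) expansion \<Rightarrow> nat \<Rightarrow> 'a list set \<Rightarrow> nat \<Rightarrow> 'a list set \<Rightarrow>
     ('a list \<Rightarrow> 'a list) \<Rightarrow> bool" where
  "definable_map R m X k Y f \<longleftrightarrow>
     definable R m X \<and> definable R k Y \<and>
     continuous_map (subtopology (Rn m) X) (subtopology (Rn k) Y) f \<and>
     definable R (m + k) {x @ f x |x. x \<in> X}"

definition times_I :: "'a::linordered_field list set \<Rightarrow> 'a list set" where
  "times_I X = {x @ [t] |x t. x \<in> X \<and> t \<in> {0..1}}"

definition closed_bounded :: "nat \<Rightarrow> 'a::linordered_field list set \<Rightarrow> bool" where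
  "closed_bounded m X \<longleftrightarrow> closedin (Rn m) X \<and> (\<exists>r. \<forall>x\<in>X. \<forall>i<m. \<bar>x ! i\<bar> \<le> r)"

definition definable_Serre_fibration ::
  "('a::linordered_field, 'f, 'r) expansion \<Rightarrow> nat \<Rightarrow> 'a list set \<Rightarrow> nat \<Rightarrow> 'a list set \<Rightarrow>
     ('a list \<Rightarrow> 'a list) \<Rightarrow> bool" where
  "definable_Serre_fibration R k E l B p \<longleftrightarrow>
     definable_map R k E l B p \<and>
     (\<forall>m X H f.
        definable R m X \<and> closed_bounded m X \<and>
        definable_map R (m + 1) (times_I X) l B H \<and>
        definable_map R m X k E f \<and>
        (\<forall>x\<in>X. p (f x) = H (x @ [0])) \<longrightarrow>
        (\<exists>H'. definable_map R (m + 1) (times_I X) k E H' \<and>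
              (\<forall>z\<in>times_I X. p (H' z) = H z) \<and>
              (\<forall>x\<in>X. H' (x @ [0]) = f x)))"

definition cube :: "nat \<Rightarrow> 'a::linordered_field list set" where
  "cube n = {t. length t = n \<and> set t \<subseteq> {0..1}}"

definition cube_boundary :: "nat \<Rightarrow> 'a::linordered_field list set" where
  "cube_boundary n = Rn n frontier_of cube n"

definition cube_face :: "nat \<Rightarrow> 'a::linordered_field list set" where
  "cube_face n = {t \<in> cube n. last t = 0}"

definition cube_J :: "nat \<Rightarrow> 'a::linordered_field list set" where
  "cube_J n = Rn n closure_of (cube_boundary n - cube_face n)"

text \<open>
  Only the values on the cube matter for membership in the following two sets of maps. Maps that
  agree on the cube are homotopic by a constant homotopy, so the quotients below are the intended
  ones although the representing functions are not made extensional.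
\<close>

definition rel_maps ::
  "('a::linordered_field, 'f, 'r) expansion \<Rightarrow> nat \<Rightarrow> nat \<Rightarrow> 'a list set \<Rightarrow> 'a list set \<Rightarrow>
     'a list \<Rightarrow> ('a list \<Rightarrow> 'a list) set" where
  "rel_maps R n k X A x\<^sub>0 =
     {f. definable_map R n (cube n) k X f \<and> f ` cube_face n \<subseteq> A \<and> f ` cube_J n = {x\<^sub>0}}"

definition abs_maps ::
  "('a::linordered_field, 'f, 'r) expansion \<Rightarrow> nat \<Rightarrow> nat \<Rightarrow> 'a list set \<Rightarrow>
     'a list \<Rightarrow> ('a list \<Rightarrow> 'a list) set" where
  "abs_maps R n k X x\<^sub>0 =
     {f. definable_map R n (cube n) k X f \<and> f ` cube_boundary n \<subseteq> {x\<^sub>0}}"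

definition homotopy_rel ::
  "('a::linordered_field, 'f, 'r) expansion \<Rightarrow> nat \<Rightarrow> nat \<Rightarrow> 'a list set \<Rightarrow>
     ('a list \<Rightarrow> 'a list) set \<Rightarrow> ('a list \<Rightarrow> 'a list) rel" where
  "homotopy_rel R n k X M =
     {(f, g). f \<in> M \<and> g \<in> M \<and>
        (\<exists>H. definable_map R (n + 1) (times_I (cube n)) k X H \<and>
             (\<forall>t\<in>cube n. H (t @ [0]) = f t) \<and>
             (\<forall>t\<in>cube n. H (t @ [1]) = g t) \<and>
             (\<forall>s\<in>{0..1}. (\<lambda>t. H (t @ [s])) \<in> M))}"

definition concat_maps ::
  "('a::linordered_field list \<Rightarrow> 'a list) \<Rightarrow> ('a list \<Rightarrow> 'a list) \<Rightarrow> 'a list \<Rightarrow> 'a list" where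
  "concat_maps f g t =
     (if 2 * hd t \<le> 1 then f ((2 * hd t) # tl t) else g ((2 * hd t - 1) # tl t))"

definition class_group ::
  "('a::linordered_field list \<Rightarrow> 'a list) set \<Rightarrow> ('a list \<Rightarrow> 'a list) rel \<Rightarrow> 'a list \<Rightarrow>
     ('a list \<Rightarrow> 'a list) set monoid" where
  "class_group M r x\<^sub>0 =
     \<lparr>carrier = M // r,
      mult = (\<lambda>c d. \<Union>f\<in>c. \<Union>g\<in>d. r `` {concat_maps f g}),
      one = r `` {\<lambda>_. x\<^sub>0}\<rparr>"

text \<open>
  Here \<open>k\<close> is the dimension of the ambient space of \<open>X\<close>. Concatenation in the first coordinate is
  compatible with the face condition only for \<open>n \<ge> 2\<close>; for \<open>n = 1\<close> only the carrier is meaningful.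
\<close>

definition rel_pi ::
  "('a::linordered_field, 'f, 'r) expansion \<Rightarrow> nat \<Rightarrow> nat \<Rightarrow> 'a list set \<Rightarrow> 'a list set \<Rightarrow>
     'a list \<Rightarrow> ('a list \<Rightarrow> 'a list) set monoid" where
  "rel_pi R n k X A x\<^sub>0 =
     class_group (rel_maps R n k X A x\<^sub>0) (homotopy_rel R n k X (rel_maps R n k X A x\<^sub>0)) x\<^sub>0"

definition abs_pi ::
  "('a::linordered_field, 'f, 'r) expansion \<Rightarrow> nat \<Rightarrow> nat \<Rightarrow> 'a list set \<Rightarrow>
     'a list \<Rightarrow> ('a list \<Rightarrow> 'a list) set monoid" where
  "abs_pi R n k X x\<^sub>0 =
     class_group (abs_maps R n k X x\<^sub>0) (homotopy_rel R n k X (abs_maps R n k X x\<^sub>0)) x\<^sub>0"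

definition induced_map ::
  "('a::linordered_field, 'f, 'r) expansion \<Rightarrow> nat \<Rightarrow> nat \<Rightarrow> 'a list set \<Rightarrow> 'a list \<Rightarrow>
     ('a list \<Rightarrow> 'a list) \<Rightarrow> ('a list \<Rightarrow> 'a list) set \<Rightarrow> ('a list \<Rightarrow> 'a list) set" where
  "induced_map R n l B b\<^sub>0 p c =
     (\<Union>f\<in>c. homotopy_rel R n l B (abs_maps R n l B b\<^sub>0) `` {p \<circ> f})"

end

theory Submission
  imports Defs
begin

text \<open>
  A lift of a map on a cube can be prescribed on the boundary minus one open face, because the
  cube together with this part of its boundary is a retract of the pair \<open>(cube \<times> I, cube \<times> 0)\<close>,
  for which the fibration has the lifting property. Lifting \<open>g : I\<^sup>n \<rightarrow> B\<close> with the constant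
  prescription \<open>e\<^sub>0\<close> gives surjectivity; lifting a homotopy between \<open>p \<circ> f\<close> and \<open>p \<circ> g\<close> with \<open>f\<close> and
  \<open>g\<close> prescribed at the two ends and \<open>e\<^sub>0\<close> on \<open>J \<times> I\<close> gives injectivity. Absolute homotopy groups are
  the relative ones of \<open>(B, {b\<^sub>0})\<close>.
\<close>

subsection \<open>Definable sets\<close>

text \<open>The face that the prescription leaves free is the one on which a map of pairs need only
  take values in the fibre. There the map to be lifted is constantly \<open>b\<^sub>0\<close>, so
  every lift lands in F by itself. The retraction has to be continuous and definable over an
  arbitrary ordered field. The textbook radial projection divides by a distance and depends on which
  face a ray meets. The one used here moves each point along a path given by sums, products,
  \<open>min\<close> and \<open>max\<close> alone, for a time given by the same operations, so
  continuity and definability both follow from a few closure lemmas. Maps are definable through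
  their graphs: the graph of a composite is a projection and the graph of a pasted map is a union.
  Coordinate substitutions bring the graphs into a common space, which is why the development starts
  with formulas.\<close>

primrec subst_term :: "(nat \<Rightarrow> ('a, 'f) fo_term) \<Rightarrow> ('a, 'f) fo_term \<Rightarrow> ('a, 'f) fo_term" where
  "subst_term \<tau> (Var i) = \<tau> i"
| "subst_term \<tau> (Const a) = Const a"
| "subst_term \<tau> (Plus s t) = Plus (subst_term \<tau> s) (subst_term \<tau> t)"
| "subst_term \<tau> (Minus s) = Minus (subst_term \<tau> s)"
| "subst_term \<tau> (Times s t) = Times (subst_term \<tau> s) (subst_term \<tau> t)"
| "subst_term \<tau> (Fn f ts) = Fn f (map (subst_term \<tau>) ts)"

lemma eval_subst_term:
  "eval_term R v (subst_term \<tau> t) = eval_term R (\<lambda>i. eval_term R v (\<tau> i)) t"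
  by (induction t) (auto intro!: arg_cong[where f = "fun_interp R _"])

text \<open>Capture is avoided semantically: no value of a term \<open>\<tau> i\<close> depends on
  variables of index at least N, so a quantifier can be renamed to the fresh \<open>Var N\<close>.
  The body then needs the bound \<open>Suc N\<close> and a changed \<open>\<tau>\<close>, hence the
  generalized induction.\<close>

lemma satisfies_subst:
  assumes "\<And>i v m a. N \<le> m \<Longrightarrow> eval_term R (v(m := a)) (\<tau> i) = eval_term R v (\<tau> i)"
  shows "\<exists>\<psi>. \<forall>v. satisfies R v \<psi> \<longleftrightarrow> satisfies R (\<lambda>i. eval_term R v (\<tau> i)) \<phi>"
  using assms
proof (induction \<phi> arbitrary: N \<tau>)
  case (Equal s t)
  show ?case by (rule exI[of _ "Equal (subst_term \<tau> s) (subst_term \<tau> t)"]) (simp add: eval_subst_term)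
next
  case (Less s t)
  show ?case by (rule exI[of _ "Less (subst_term \<tau> s) (subst_term \<tau> t)"]) (simp add: eval_subst_term)
next
  case (Rel r ts)
  show ?case
    by (rule exI[of _ "Rel r (map (subst_term \<tau>) ts)"]) (simp add: eval_subst_term comp_def)
next
  case (Neg \<phi>)
  then obtain \<psi> where "\<forall>v. satisfies R v \<psi> \<longleftrightarrow> satisfies R (\<lambda>i. eval_term R v (\<tau> i)) \<phi>" by blast
  then show ?case by (intro exI[of _ "Neg \<psi>"]) simp
next
  case (Conj \<phi>1 \<phi>2)
  obtain \<psi>1 where "\<forall>v. satisfies R v \<psi>1 \<longleftrightarrow> satisfies R (\<lambda>i. eval_term R v (\<tau> i)) \<phi>1"
    using Conj.IH(1) Conj.prems by blast
  moreover obtain \<psi>2 where "\<forall>v. satisfies R v \<psi>2 \<longleftrightarrow> satisfies R (\<lambda>i. eval_term R v (\<tau> i)) \<phi>2"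
    using Conj.IH(2) Conj.prems by blast
  ultimately show ?case by (intro exI[of _ "Conj \<psi>1 \<psi>2"]) simp
next
  case (Exists i \<phi>)
  have "eval_term R (v(m := a)) ((\<tau>(i := Var N)) j) = eval_term R v ((\<tau>(i := Var N)) j)"
    if "Suc N \<le> m" for j v m a
    using Exists.prems[of m v a j] that by (cases "j = i") (simp_all add: fun_upd_def)
  from Exists.IH[of "Suc N" "\<tau>(i := Var N)", OF this] obtain \<psi>
    where \<psi>: "satisfies R v \<psi> \<longleftrightarrow> satisfies R (\<lambda>j. eval_term R v ((\<tau>(i := Var N)) j)) \<phi>" for v
    by blast
  have "(\<lambda>j. eval_term R (v(N := a)) ((\<tau>(i := Var N)) j)) = (\<lambda>j. eval_term R v (\<tau> j))(i := a)" for v a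
    using Exists.prems[of N v a] by (simp add: fun_eq_iff fun_upd_def)
  then show ?case by (intro exI[of _ "Exists N \<psi>"]) (simp add: \<psi>)
qed

section \<open>Boolean combinations, coordinate substitutions and projections\<close>

lemma definable_length: "definable R n S \<Longrightarrow> x \<in> S \<Longrightarrow> length x = n"
  by (auto simp: definable_def)

lemma definable_Collect:
  assumes "\<And>x. length x = n \<Longrightarrow> satisfies R (assignment x) \<phi> \<longleftrightarrow> P x"
  shows "definable R n {x. length x = n \<and> P x}"
  unfolding definable_def using assms by (intro exI[of _ \<phi>]) auto

lemma definable_Int:
  assumes "definable R n S" "definable R n T"
  shows "definable R n (S \<inter> T)"
proof -
  obtain \<phi> \<psi> where "S = {x. length x = n \<and> satisfies R (assignment x) \<phi>}"
    "T = {x. length x = n \<and> satisfies R (assignment x) \<psi>}"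
    using assms by (auto simp: definable_def)
  then show ?thesis unfolding definable_def by (intro exI[of _ "Conj \<phi> \<psi>"]) auto
qed

lemma definable_Diff:
  assumes "definable R n S" "definable R n T"
  shows "definable R n (S - T)"
proof -
  obtain \<phi> \<psi> where "S = {x. length x = n \<and> satisfies R (assignment x) \<phi>}"
    "T = {x. length x = n \<and> satisfies R (assignment x) \<psi>}"
    using assms by (auto simp: definable_def)
  then show ?thesis unfolding definable_def by (intro exI[of _ "Conj \<phi> (Neg \<psi>)"]) auto
qed

lemma definable_all: "definable R n {x. length x = n}"
  using definable_Collect[of n R "Equal (Const 0) (Const 0)" "\<lambda>_. True"] by simp

lemma definable_Un:
  assumes "definable R n S" "definable R n T"
  shows "definable R n (S \<union> T)"
proof -
  let ?L = "{x. length x = n}"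
  have "S \<union> T = ?L - ((?L - S) \<inter> (?L - T))"
    using assms by (auto dest: definable_length)
  then show ?thesis
    using assms by (metis definable_all definable_Diff definable_Int)
qed

text \<open>The index i is a natural number outside the formula language, so the quantifier is a
  finite conjunction and is handled by induction on its bound.\<close>

lemma definable_Ball:
  fixes k :: nat
  assumes "definable R n S" "\<And>i. i < k \<Longrightarrow> definable R n {x \<in> S. P i x}"
  shows "definable R n {x \<in> S. \<forall>i<k. P i x}"
  using assms
proof (induction k)
  case 0
  then show ?case by simp
next
  case (Suc k)
  have "{x \<in> S. \<forall>i<Suc k. P i x} = {x \<in> S. \<forall>i<k. P i x} \<inter> {x \<in> S. P k x}"
    by (auto simp: less_Suc_eq)
  then show ?case using Suc by (simp add: definable_Int)
qed

lemma definable_not: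
  assumes "definable R n S" "definable R n {x \<in> S. P x}"
  shows "definable R n {x \<in> S. \<not> P x}"
proof -
  have "{x \<in> S. \<not> P x} = S - {x \<in> S. P x}" by auto
  then show ?thesis using assms by (simp add: definable_Diff)
qed

lemma definable_disj:
  assumes "definable R n {x \<in> S. P x}" "definable R n {x \<in> S. Q x}"
  shows "definable R n {x \<in> S. P x \<or> Q x}"
  using definable_Un[OF assms] by (simp add: Collect_disj_eq[symmetric] conj_disj_distribL)

lemma definable_Bex:
  fixes k :: nat
  assumes "definable R n S" "\<And>i. i < k \<Longrightarrow> definable R n {x \<in> S. P i x}"
  shows "definable R n {x \<in> S. \<exists>i<k. P i x}"
proof -
  have "definable R n {x \<in> S. \<not> (\<forall>i<k. \<not> P i x)}"
    using assms by (intro definable_not definable_Ball)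
  then show ?thesis by simp
qed

text \<open>The list \<open>is\<close> may permute, repeat or omit coordinates. Conditions on
  different blocks of variables can thus be placed in one larger space and intersected
  there.\<close>

lemma definable_reindex:
  assumes S: "definable R m S" and len: "length is = m" and bd: "\<forall>i\<in>set is. i < n"
  shows "definable R n {x. length x = n \<and> map ((!) x) is \<in> S}"
proof -
  obtain \<phi> where \<phi>: "S = {x. length x = m \<and> satisfies R (assignment x) \<phi>}"
    using S by (auto simp: definable_def)
  \<comment> \<open>Indices from m on go to 0, in agreement with the default value of
    \<open>assignment\<close>.\<close>
  define \<tau> :: "nat \<Rightarrow> ('a, 'b) fo_term" where "\<tau> i = (if i < m then Var (is ! i) else Const 0)" for i
  have "eval_term R (v(j := a)) (\<tau> i) = eval_term R v (\<tau> i)" if "n \<le> j" for i v j a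
    using that bd len nth_mem[of i "is"] by (cases "i < m") (fastforce simp: \<tau>_def)+
  from satisfies_subst[of n R \<tau> \<phi>, OF this] obtain \<psi>
    where \<psi>: "satisfies R v \<psi> \<longleftrightarrow> satisfies R (\<lambda>i. eval_term R v (\<tau> i)) \<phi>" for v
    by auto
  have "(\<lambda>i. eval_term R (assignment x) (\<tau> i)) = assignment (map ((!) x) is)" if "length x = n" for x
    using that len bd by (auto simp: fun_eq_iff \<tau>_def assignment_def)
  then show ?thesis
    by (intro definable_Collect[where \<phi> = \<psi>]) (simp add: \<psi> \<phi> len)
qed

text \<open>The bound variable has index n, just past the entries of x, so that updating the
  assignment there amounts to appending a.\<close>

lemma definable_ex1:
  assumes "definable R (Suc n) S"
  shows "definable R n {x. length x = n \<and> (\<exists>a. x @ [a] \<in> S)}"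
proof -
  obtain \<phi> where \<phi>: "S = {x. length x = Suc n \<and> satisfies R (assignment x) \<phi>}"
    using assms by (auto simp: definable_def)
  have "(assignment x)(n := a) = assignment (x @ [a])" if "length x = n" for x :: "'a list" and a
    using that by (auto simp: fun_eq_iff assignment_def nth_append)
  then show ?thesis
    by (intro definable_Collect[where \<phi> = "Exists n \<phi>"]) (simp add: \<phi>)
qed

lemma definable_ex:
  assumes "definable R (n + k) S"
  shows "definable R n {x. length x = n \<and> (\<exists>y. length y = k \<and> x @ y \<in> S)}"
  using assms
proof (induction k arbitrary: S)
  case 0
  then have "{x. length x = n \<and> (\<exists>y. length y = 0 \<and> x @ y \<in> S)} = S"
    by (auto dest: definable_length)
  with 0 show ?case by simp
next
  case (Suc k)
  have "{x. length x = n \<and> (\<exists>y. length y = Suc k \<and> x @ y \<in> S)} =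
    {x. length x = n \<and> (\<exists>y. length y = k \<and> x @ y \<in> {z. length z = n + k \<and> (\<exists>a. z @ [a] \<in> S)})}"
    (is "?A = ?B")
  proof (rule Set.set_eqI)
    fix x
    show "x \<in> ?A \<longleftrightarrow> x \<in> ?B"
    proof
      assume "x \<in> ?A"
      then obtain y where "length x = n" "length y = Suc k" "x @ y \<in> S" by auto
      then show "x \<in> ?B"
        by (cases y rule: rev_cases) auto
    next
      assume "x \<in> ?B"
      then obtain y a where "length x = n" "length y = k" "x @ y @ [a] \<in> S" by auto
      then show "x \<in> ?A"
        by (auto intro!: exI[of _ "y @ [a]"])
    qed
  qed
  with Suc.IH[OF definable_ex1] Suc.prems show ?case by simp
qed

lemma map_nth_upt: "b \<le> length u \<Longrightarrow> map ((!) u) [a..<b] = drop a (take b u)"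
  by (rule nth_equalityI) auto

subsection \<open>The topology of \<open>R\<^sup>n\<close>\<close>

text \<open>Sup-norm distance below e, kept as a relation because the field is arbitrary and its
  distances need not be real numbers.\<close>

definition close :: "nat \<Rightarrow> 'a::linordered_field \<Rightarrow> 'a list \<Rightarrow> 'a list \<Rightarrow> bool" where
  "close n e x y \<longleftrightarrow> (\<forall>i<n. \<bar>x ! i - y ! i\<bar> < e)"

lemma closeD: "close n e x y \<Longrightarrow> i < n \<Longrightarrow> \<bar>x ! i - y ! i\<bar> < e"
  by (simp add: close_def)

lemma close_mono: "close n d x y \<Longrightarrow> d \<le> e \<Longrightarrow> close n e x y"
  by (force simp: close_def)

lemma close_refl: "0 < e \<Longrightarrow> close n e x x"
  by (simp add: close_def)

lemma finite_pos_lower_bound: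
  fixes g :: "nat \<Rightarrow> 'a::linordered_field"
  assumes "\<And>i. i < n \<Longrightarrow> 0 < g i"
  shows "\<exists>e>0. \<forall>i<n. e \<le> g i"
  using assms
proof (induction n)
  case 0
  show ?case by (intro exI[of _ 1]) simp
next
  case (Suc n)
  then obtain e where "e > 0" "\<forall>i<n. e \<le> g i" by auto
  with Suc.prems show ?case
    by (intro exI[of _ "min e (g n)"]) (auto simp: less_Suc_eq min_le_iff_disj)
qed

text \<open>Boxes and sup-norm balls generate the same topology: a point of a box has a positive
  distance from its finitely many faces, and a ball is itself a box.\<close>

lemma openin_Rn:
  "openin (Rn n) U \<longleftrightarrow>
     (\<forall>x\<in>U. length x = n \<and> (\<exists>e>0. \<forall>y. length y = n \<and> close n e x y \<longrightarrow> y \<in> U))"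
  (is "_ \<longleftrightarrow> ?R U")
proof
  assume "openin (Rn n) U"
  then have "generate_topology_on {open_box a b |a b. length a = n \<and> length b = n} U"
    by (simp add: Rn_def openin_topology_generated_by_iff)
  then show "?R U"
  proof induction
    case Empty
    show ?case by simp
  next
    case (Int a b)
    show ?case
    proof
      fix x assume x: "x \<in> a \<inter> b"
      obtain e where e: "e > 0" "\<forall>y. length y = n \<and> close n e x y \<longrightarrow> y \<in> a"
        using Int x by blast
      obtain e' where e': "e' > 0" "\<forall>y. length y = n \<and> close n e' x y \<longrightarrow> y \<in> b"
        using Int x by blast
      have "y \<in> a \<inter> b" if "length y = n" "close n (min e e') x y" for y
        using e(2) e'(2) that close_mono[of n "min e e'" x y] by simp
      moreover have "length x = n" using Int x by blast
      moreover have "min e e' > 0" using e(1) e'(1) by simp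
      ultimately show "length x = n \<and> (\<exists>e>0. \<forall>y. length y = n \<and> close n e x y \<longrightarrow> y \<in> a \<inter> b)"
        by blast
    qed
  next
    case (UN K)
    then show ?case by (meson UnionE UnionI)
  next
    case (Basis s)
    then obtain a b where s: "s = open_box a b" "length a = n" "length b = n" by auto
    show ?case
    proof
      fix x assume x: "x \<in> s"
      have "\<exists>e>0. \<forall>i<n. e \<le> min (x ! i - a ! i) (b ! i - x ! i)"
        using x s by (intro finite_pos_lower_bound) (auto simp: open_box_def)
      then obtain e where e: "e > 0" "\<And>i. i < n \<Longrightarrow> e \<le> min (x ! i - a ! i) (b ! i - x ! i)" by auto
      have "y \<in> s" if "length y = n" "close n e x y" for y
        using e(2) that s by (fastforce simp: open_box_def close_def)
      with e(1) x s show "length x = n \<and> (\<exists>e>0. \<forall>y. length y = n \<and> close n e x y \<longrightarrow> y \<in> s)"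
        by (auto simp: open_box_def)
    qed
  qed
next
  assume U: "?R U"
  show "openin (Rn n) U"
    unfolding openin_subopen[of _ U]
  proof
    fix x assume "x \<in> U"
    with U obtain e where e: "length x = n" "e > 0" "\<forall>y. length y = n \<and> close n e x y \<longrightarrow> y \<in> U"
      by blast
    let ?T = "open_box (map (\<lambda>t. t - e) x) (map (\<lambda>t. t + e) x)"
    have "openin (Rn n) ?T"
      unfolding Rn_def using e(1) by (intro topology_generated_by_Basis) (auto intro!: exI)
    moreover have "x \<in> ?T" using e by (auto simp: open_box_def)
    moreover have "close n e x y" if "y \<in> ?T" for y
      using that e(1) by (fastforce simp: open_box_def close_def abs_less_iff)
    then have "?T \<subseteq> U" using e by (auto simp: open_box_def)
    ultimately show "\<exists>T. openin (Rn n) T \<and> x \<in> T \<and> T \<subseteq> U" by blast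
  qed
qed

lemma topspace_Rn: "topspace (Rn n) = {x. length x = n}"
proof -
  have "openin (Rn n) {x. length x = n}"
    unfolding openin_Rn by (auto intro: exI[of _ 1])
  then have "{x. length x = n} \<subseteq> topspace (Rn n)" by (rule openin_subset)
  moreover have "openin (Rn n) (topspace (Rn n))" by simp
  then have "topspace (Rn n) \<subseteq> {x. length x = n}" unfolding openin_Rn by blast
  ultimately show ?thesis by blast
qed

lemma openin_Rn_close:
  fixes e :: "'a::linordered_field"
  shows "openin (Rn n) {y. length y = n \<and> close n e x y}"
  unfolding openin_Rn
proof
  fix y assume y: "y \<in> {y. length y = n \<and> close n e x y}"
  have "\<exists>d>0. \<forall>i<n. d \<le> e - \<bar>x ! i - y ! i\<bar>"
    using y by (intro finite_pos_lower_bound) (auto simp: close_def)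
  then obtain d where d: "d > 0" "\<And>i. i < n \<Longrightarrow> d \<le> e - \<bar>x ! i - y ! i\<bar>" by auto
  have "close n e x z" if "close n d y z" for z
    unfolding close_def
  proof (intro allI impI)
    fix i assume "i < n"
    then show "\<bar>x ! i - z ! i\<bar> < e" using d(2)[of i] closeD[OF that, of i] by linarith
  qed
  with d y show "length y = n \<and>
      (\<exists>e'>0. \<forall>z. length z = n \<and> close n e' y z \<longrightarrow> z \<in> {y. length y = n \<and> close n e x y})"
    by auto
qed

definition continuous_coords ::
  "nat \<Rightarrow> 'a::linordered_field list set \<Rightarrow> nat \<Rightarrow> ('a list \<Rightarrow> 'a list) \<Rightarrow> bool" where
  "continuous_coords m X k f \<longleftrightarrow>
     (\<forall>x\<in>X. \<forall>e>0. \<exists>d>0. \<forall>y\<in>X. close m d x y \<longrightarrow> close k e (f x) (f y))"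

lemma continuous_coordsD:
  assumes "continuous_coords m X k f" "x \<in> X" "e > 0"
  obtains d where "d > 0" "\<And>y. y \<in> X \<Longrightarrow> close m d x y \<Longrightarrow> close k e (f x) (f y)"
  using assms unfolding continuous_coords_def by blast

lemma continuous_map_Rn:
  assumes X: "\<And>x. x \<in> X \<Longrightarrow> length x = m" and Y: "\<And>y. y \<in> Y \<Longrightarrow> length y = k"
  shows "continuous_map (subtopology (Rn m) X) (subtopology (Rn k) Y) f \<longleftrightarrow>
    f ` X \<subseteq> Y \<and> continuous_coords m X k f"
    (is "?L \<longleftrightarrow> ?R")
proof -
  have topX: "topspace (subtopology (Rn m) X) = X"
    using X by (auto simp: topspace_Rn)
  show ?thesis
  proof
    assume L: ?L
    then have "f ` topspace (subtopology (Rn m) X) \<subseteq> topspace (subtopology (Rn k) Y)"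
      by (rule continuous_map_image_subset_topspace)
    then have fXY: "f ` X \<subseteq> Y" unfolding topX by auto
    moreover have "continuous_coords m X k f"
      unfolding continuous_coords_def
    proof (intro ballI allI impI)
      fix x and e :: 'a
      assume x: "x \<in> X" and e: "e > 0"
      have "continuous_map (subtopology (Rn m) X) (Rn k) f"
        using L continuous_map_in_subtopology by blast
      then have "openin (subtopology (Rn m) X)
          {z \<in> topspace (subtopology (Rn m) X). f z \<in> {y. length y = k \<and> close k e (f x) y}}"
        by (rule openin_continuous_map_preimage) (rule openin_Rn_close)
      then obtain T where T: "openin (Rn m) T"
        "{z \<in> X. f z \<in> {y. length y = k \<and> close k e (f x) y}} = T \<inter> X"
        unfolding topX openin_subtopology by blast
      have "x \<in> T" using T(2) x fXY Y e close_refl by blast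
      then obtain d where "d > 0" "\<forall>y. length y = m \<and> close m d x y \<longrightarrow> y \<in> T"
        using T(1) unfolding openin_Rn by blast
      then show "\<exists>d>0. \<forall>y\<in>X. close m d x y \<longrightarrow> close k e (f x) (f y)"
        using T(2) X by blast
    qed
    ultimately show ?R by blast
  next
    assume R: ?R
    have "continuous_map (subtopology (Rn m) X) (Rn k) f"
      unfolding continuous_map_def topX
    proof (intro conjI allI impI)
      show "f \<in> X \<rightarrow> topspace (Rn k)" using R Y by (auto simp: topspace_Rn)
      fix U :: "'a list set"
      assume U: "openin (Rn k) U"
      show "openin (subtopology (Rn m) X) {x \<in> X. f x \<in> U}"
        unfolding openin_subopen[of _ "{x \<in> X. f x \<in> U}"]
      proof
        fix x assume x: "x \<in> {x \<in> X. f x \<in> U}"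
        then obtain e where e: "e > 0" "\<forall>y. length y = k \<and> close k e (f x) y \<longrightarrow> y \<in> U"
          using U unfolding openin_Rn by blast
        obtain d where d: "d > 0" "\<And>y. y \<in> X \<Longrightarrow> close m d x y \<Longrightarrow> close k e (f x) (f y)"
          using R x e(1) continuous_coordsD by blast
        have "openin (subtopology (Rn m) X) ({y. length y = m \<and> close m d x y} \<inter> X)"
          using openin_Rn_close openin_subtopology by blast
        moreover have "{y. length y = m \<and> close m d x y} \<inter> X \<subseteq> {x \<in> X. f x \<in> U}"
          using d e R Y by blast
        moreover have "x \<in> {y. length y = m \<and> close m d x y} \<inter> X"
          using x X d close_refl by blast
        ultimately show "\<exists>T. openin (subtopology (Rn m) X) T \<and> x \<in> T \<and> T \<subseteq> {x \<in> X. f x \<in> U}"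
          by blast
      qed
    qed
    with R show ?L by (auto simp: continuous_map_in_subtopology topX)
  qed
qed

text \<open>\<open>cube_boundary\<close> and \<open>cube_J\<close> are given by a frontier and a
  closure; this form makes both computable coordinate by coordinate.\<close>

lemma closure_of_Rn:
  assumes "\<And>x. x \<in> S \<Longrightarrow> length x = n"
  shows "Rn n closure_of S = {x. length x = n \<and> (\<forall>e>0. \<exists>y\<in>S. close n e x y)}"
proof (rule Set.set_eqI)
  fix x :: "'a list"
  have "(\<forall>T. x \<in> T \<and> openin (Rn n) T \<longrightarrow> (\<exists>y\<in>S. y \<in> T)) \<longleftrightarrow> (\<forall>e>0. \<exists>y\<in>S. close n e x y)"
    if len: "length x = n"
  proof
    assume L: "\<forall>T. x \<in> T \<and> openin (Rn n) T \<longrightarrow> (\<exists>y\<in>S. y \<in> T)"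
    show "\<forall>e>0. \<exists>y\<in>S. close n e x y"
    proof (intro allI impI)
      fix e :: 'a assume "e > 0"
      then have "x \<in> {y. length y = n \<and> close n e x y}"
        using len by (simp add: close_refl)
      then show "\<exists>y\<in>S. close n e x y"
        using L[rule_format, OF conjI[OF _ openin_Rn_close[of n e x]]] by auto
    qed
  next
    assume R: "\<forall>e>0. \<exists>y\<in>S. close n e x y"
    show "\<forall>T. x \<in> T \<and> openin (Rn n) T \<longrightarrow> (\<exists>y\<in>S. y \<in> T)"
    proof (intro allI impI)
      fix T assume T: "x \<in> T \<and> openin (Rn n) T"
      then obtain e where "e > 0" "\<forall>y. length y = n \<and> close n e x y \<longrightarrow> y \<in> T"
        unfolding openin_Rn by blast
      with R assms show "\<exists>y\<in>S. y \<in> T" by meson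
    qed
  qed
  then show "x \<in> Rn n closure_of S \<longleftrightarrow> x \<in> {x. length x = n \<and> (\<forall>e>0. \<exists>y\<in>S. close n e x y)}"
    unfolding closure_of_def topspace_Rn by auto
qed

subsection \<open>Definable continuous maps\<close>

text \<open>\<open>definable_map\<close> without its target set. Composition and pasting can then be
  treated apart from the question of where the values lie; \<open>definable_map_iff\<close> restores
  the target.\<close>

definition dmap ::
  "('a::linordered_field, 'f, 'r) expansion \<Rightarrow> nat \<Rightarrow> 'a list set \<Rightarrow> nat \<Rightarrow>
     ('a list \<Rightarrow> 'a list) \<Rightarrow> bool" where
  "dmap R m X k f \<longleftrightarrow>
     definable R m X \<and> (\<forall>x\<in>X. length (f x) = k) \<and>
     definable R (m + k) {x @ f x |x. x \<in> X} \<and> continuous_coords m X k f"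

lemma dmap_definable: "dmap R m X k f \<Longrightarrow> definable R m X"
  by (simp add: dmap_def)

lemma dmap_length: "dmap R m X k f \<Longrightarrow> x \<in> X \<Longrightarrow> length (f x) = k"
  by (simp add: dmap_def)

lemma definable_map_iff:
  "definable_map R m X k Y f \<longleftrightarrow> dmap R m X k f \<and> definable R k Y \<and> f ` X \<subseteq> Y"
proof (cases "definable R m X \<and> definable R k Y")
  case True
  then have "continuous_map (subtopology (Rn m) X) (subtopology (Rn k) Y) f \<longleftrightarrow>
      f ` X \<subseteq> Y \<and> continuous_coords m X k f"
    by (intro continuous_map_Rn) (auto dest: definable_length)
  moreover have "\<forall>x\<in>X. length (f x) = k" if "f ` X \<subseteq> Y"
    using that True by (auto dest: definable_length)
  ultimately show ?thesis using True by (auto simp: definable_map_def dmap_def)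
next
  case False
  then show ?thesis by (auto simp: definable_map_def dmap_def)
qed

text \<open>Splitting w by \<open>take\<close> and \<open>drop\<close> states the graph as a
  condition on one list, which is the form that coordinate substitutions act on.\<close>

lemma graph_eq:
  assumes "definable R m X" "\<And>x. x \<in> X \<Longrightarrow> length (f x) = k"
  shows "{x @ f x |x. x \<in> X} = {w. length w = m + k \<and> take m w \<in> X \<and> f (take m w) = drop m w}"
proof (rule Set.set_eqI)
  fix w
  show "w \<in> {x @ f x |x. x \<in> X} \<longleftrightarrow>
      w \<in> {w. length w = m + k \<and> take m w \<in> X \<and> f (take m w) = drop m w}"
  proof
    assume "w \<in> {x @ f x |x. x \<in> X}"
    then obtain x where "w = x @ f x" "x \<in> X" by auto
    with assms show "w \<in> {w. length w = m + k \<and> take m w \<in> X \<and> f (take m w) = drop m w}"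
      by (auto dest: definable_length)
  next
    assume "w \<in> {w. length w = m + k \<and> take m w \<in> X \<and> f (take m w) = drop m w}"
    then show "w \<in> {x @ f x |x. x \<in> X}"
      by (auto intro!: exI[of _ "take m w"] simp: append_take_drop_id)
  qed
qed

lemma dmap_graph:
  assumes "dmap R m X k f"
  shows "definable R (m + k) {w. length w = m + k \<and> take m w \<in> X \<and> f (take m w) = drop m w}"
  using assms graph_eq[of R m X f k] by (simp add: dmap_def)

lemma dmapI:
  assumes "definable R m X" "\<And>x. x \<in> X \<Longrightarrow> length (f x) = k"
    "definable R (m + k) {w. length w = m + k \<and> take m w \<in> X \<and> f (take m w) = drop m w}"
    "continuous_coords m X k f"
  shows "dmap R m X k f"
  using assms graph_eq[of R m X f k] by (simp add: dmap_def)

lemma dmap_cong: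
  assumes "dmap R m X k f" "\<And>x. x \<in> X \<Longrightarrow> f x = g x"
  shows "dmap R m X k g"
proof -
  have "{x @ g x |x. x \<in> X} = {x @ f x |x. x \<in> X}"
    using assms(2) by fastforce
  then show ?thesis using assms by (simp add: dmap_def continuous_coords_def)
qed

text \<open>The preimage is the projection of the part of the graph that lies over A.\<close>

lemma definable_vimage:
  assumes f: "dmap R m X k f" and A: "definable R k A"
  shows "definable R m {x \<in> X. f x \<in> A}"
proof -
  let ?S = "{w. length w = m + k \<and> take m w \<in> X \<and> f (take m w) = drop m w} \<inter>
     {w. length w = m + k \<and> map ((!) w) [m..<m + k] \<in> A}"
  have "definable R (m + k) {w. length w = m + k \<and> map ((!) w) [m..<m + k] \<in> A}"
    using A by (intro definable_reindex) auto
  from definable_ex[OF definable_Int[OF dmap_graph[OF f] this]]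
  have "definable R m {x. length x = m \<and> (\<exists>y. length y = k \<and> x @ y \<in> ?S)}" .
  also have "{x. length x = m \<and> (\<exists>y. length y = k \<and> x @ y \<in> ?S)} = {x \<in> X. f x \<in> A}"
    (is "?L = ?B")
  proof (rule Set.set_eqI)
    fix x
    have "x @ y \<in> ?S \<longleftrightarrow> x \<in> X \<and> f x = y \<and> y \<in> A" if "length x = m" "length y = k" for y
      using that by (simp add: map_nth_upt)
    then show "x \<in> ?L \<longleftrightarrow> x \<in> ?B"
      using dmap_length[OF f] definable_length[OF dmap_definable[OF f]] by blast
  qed
  finally show ?thesis .
qed

lemma dmap_compose:
  assumes f: "dmap R m X k f" and g: "dmap R k Y l g" and fXY: "\<And>x. x \<in> X \<Longrightarrow> f x \<in> Y"
  shows "dmap R m X l (\<lambda>x. g (f x))"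
proof (rule dmapI)
  show "definable R m X" using f by (rule dmap_definable)
  show "length (g (f x)) = l" if "x \<in> X" for x
    using that fXY dmap_length[OF g] by auto
  let ?Gf = "{w. length w = m + k \<and> take m w \<in> X \<and> f (take m w) = drop m w}"
  let ?Gg = "{w. length w = k + l \<and> take k w \<in> Y \<and> g (take k w) = drop k w}"
  \<comment> \<open>The blocks are x, the final value, and the intermediate value
    \<open>f x\<close>. The last comes at the end because \<open>definable_ex\<close> projects away
    the final block.\<close>
  let ?S = "{u. length u = m + l + k \<and> map ((!) u) ([0..<m] @ [m + l..<m + l + k]) \<in> ?Gf} \<inter>
    {u. length u = m + l + k \<and> map ((!) u) ([m + l..<m + l + k] @ [m..<m + l]) \<in> ?Gg}"
  have "definable R (m + l + k) ?S"
    by (intro definable_Int definable_reindex[OF dmap_graph[OF f]] definable_reindex[OF dmap_graph[OF g]])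
      auto
  from definable_ex[OF this]
  have "definable R (m + l) {w. length w = m + l \<and> (\<exists>y. length y = k \<and> w @ y \<in> ?S)}" .
  also have "{w. length w = m + l \<and> (\<exists>y. length y = k \<and> w @ y \<in> ?S)} =
      {w. length w = m + l \<and> take m w \<in> X \<and> g (f (take m w)) = drop m w}" (is "?A = ?B")
  proof (rule Set.set_eqI)
    fix w
    have "w @ y \<in> ?S \<longleftrightarrow> take m w \<in> X \<and> f (take m w) = y \<and> y \<in> Y \<and> g y = drop m w"
      if "length w = m + l" "length y = k" for y
      using that by (auto simp: map_nth_upt)
    then show "w \<in> ?A \<longleftrightarrow> w \<in> ?B"
      using dmap_length[OF f] fXY by blast
  qed
  finally show "definable R (m + l) ?B" .
  show "continuous_coords m X l (\<lambda>x. g (f x))"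
    unfolding continuous_coords_def
  proof (intro ballI allI impI)
    fix x and e :: 'a assume x: "x \<in> X" and e: "e > 0"
    obtain d where d: "d > 0" "\<And>y. y \<in> Y \<Longrightarrow> close k d (f x) y \<Longrightarrow> close l e (g (f x)) (g y)"
      using g fXY[OF x] e continuous_coordsD unfolding dmap_def by blast
    obtain d' where d': "d' > 0" "\<And>y. y \<in> X \<Longrightarrow> close m d' x y \<Longrightarrow> close k d (f x) (f y)"
      using f x d(1) continuous_coordsD unfolding dmap_def by blast
    show "\<exists>d>0. \<forall>y\<in>X. close m d x y \<longrightarrow> close l e (g (f x)) (g (f y))"
      using d d' fXY by blast
  qed
qed

lemma close_append:
  assumes "length a = k" "length b = k"
  shows "close (k + l) e (a @ c) (b @ d) \<longleftrightarrow> close k e a b \<and> close l e c d"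
proof -
  have "(\<forall>i<k + l. P i) \<longleftrightarrow> (\<forall>i<k. P i) \<and> (\<forall>i<l. P (k + i))" for P :: "nat \<Rightarrow> bool"
    by (metis add.commute less_add_same_cancel2 nat_add_left_cancel_less not_less_iff_gr_or_eq
        less_imp_add_positive trans_less_add1 add_0_right)
  then show ?thesis using assms by (simp add: close_def nth_append)
qed

lemma dmap_append:
  assumes f: "dmap R m X k f" and g: "dmap R m X l g"
  shows "dmap R m X (k + l) (\<lambda>x. f x @ g x)"
proof (rule dmapI)
  show "definable R m X" using f by (rule dmap_definable)
  show "length (f x @ g x) = k + l" if "x \<in> X" for x
    using that dmap_length[OF f] dmap_length[OF g] by auto
  let ?Gf = "{w. length w = m + k \<and> take m w \<in> X \<and> f (take m w) = drop m w}"
  let ?Gg = "{w. length w = m + l \<and> take m w \<in> X \<and> g (take m w) = drop m w}"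
  let ?S = "{u. length u = m + (k + l) \<and> map ((!) u) [0..<m + k] \<in> ?Gf} \<inter>
    {u. length u = m + (k + l) \<and> map ((!) u) ([0..<m] @ [m + k..<m + k + l]) \<in> ?Gg}"
  have "definable R (m + (k + l)) ?S"
    by (intro definable_Int definable_reindex[OF dmap_graph[OF f]] definable_reindex[OF dmap_graph[OF g]])
      auto
  also have "?S = {w. length w = m + (k + l) \<and> take m w \<in> X \<and> f (take m w) @ g (take m w) = drop m w}"
    (is "_ = ?B")
  proof (rule Set.set_eqI)
    fix w
    have "w \<in> ?S \<longleftrightarrow> w \<in> ?B" if w: "length w = m + (k + l)"
    proof -
      obtain x y z where "w = x @ y @ z" "length x = m" "length y = k" "length z = l"
        using w that[of "take m w" "take k (drop m w)" "drop k (drop m w)"]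
        by (metis (no_types, lifting) append_take_drop_id add_diff_cancel_left' le_add1 length_drop
            length_take min.absorb2)
      then show ?thesis
        using dmap_length[OF f] by (auto simp: map_nth_upt)
    qed
    then show "w \<in> ?S \<longleftrightarrow> w \<in> ?B" by blast
  qed
  finally show "definable R (m + (k + l)) ?B" .
  show "continuous_coords m X (k + l) (\<lambda>x. f x @ g x)"
    unfolding continuous_coords_def
  proof (intro ballI allI impI)
    fix x and e :: 'a assume x: "x \<in> X" and e: "e > 0"
    obtain d where d: "d > 0" "\<And>y. y \<in> X \<Longrightarrow> close m d x y \<Longrightarrow> close k e (f x) (f y)"
      using f x e continuous_coordsD unfolding dmap_def by blast
    obtain d' where d': "d' > 0" "\<And>y. y \<in> X \<Longrightarrow> close m d' x y \<Longrightarrow> close l e (g x) (g y)"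
      using g x e continuous_coordsD unfolding dmap_def by blast
    have "close (k + l) e (f x @ g x) (f y @ g y)" if "y \<in> X" "close m (min d d') x y" for y
      using d(2)[OF that(1)] d'(2)[OF that(1)] close_mono[OF that(2)] x that(1)
      by (simp add: close_append dmap_length[OF f])
    moreover have "min d d' > 0" using d(1) d'(1) by simp
    ultimately show "\<exists>d>0. \<forall>y\<in>X. close m d x y \<longrightarrow> close (k + l) e (f x @ g x) (f y @ g y)"
      by blast
  qed
qed

section \<open>Pasting along relatively closed pieces\<close>

definition closed_within :: "nat \<Rightarrow> 'a::linordered_field list set \<Rightarrow> 'a list set \<Rightarrow> bool" where
  "closed_within m X A \<longleftrightarrow> (\<forall>x\<in>X - A. \<exists>d>0. \<forall>y\<in>X. close m d x y \<longrightarrow> y \<notin> A)"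

text \<open>Near a point x of X each piece either contains x or is absent, so a radius can be found
  for each piece separately and the smaller one taken. The graph is the union of the two
  graphs.\<close>

lemma dmap_paste:
  assumes f: "dmap R m A k f" and g: "dmap R m B k g" and X: "X = A \<union> B"
    and A: "closed_within m X A" and B: "closed_within m X B"
    and eq: "\<And>x. x \<in> A \<Longrightarrow> x \<in> B \<Longrightarrow> f x = g x"
  shows "dmap R m X k (\<lambda>x. if x \<in> A then f x else g x)" (is "dmap R m X k ?h")
proof -
  have "definable R m X"
    using f g X definable_Un dmap_definable by blast
  moreover have "\<forall>x\<in>X. length (?h x) = k"
    using X dmap_length[OF f] dmap_length[OF g] by auto
  moreover have "{x @ ?h x |x. x \<in> X} = {x @ f x |x. x \<in> A} \<union> {x @ g x |x. x \<in> B}"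
    using X eq by fastforce
  then have "definable R (m + k) {x @ ?h x |x. x \<in> X}"
    using f g by (simp add: dmap_def definable_Un)
  moreover have "continuous_coords m X k ?h"
    unfolding continuous_coords_def
  proof (intro ballI allI impI)
    fix x and e :: 'a assume x: "x \<in> X" and e: "e > 0"
    have "\<exists>d>0. \<forall>y\<in>A. close m d x y \<longrightarrow> close k e (?h x) (?h y)"
    proof (cases "x \<in> A")
      case True
      then obtain d where "d > 0" "\<And>y. y \<in> A \<Longrightarrow> close m d x y \<Longrightarrow> close k e (f x) (f y)"
        using f e continuous_coordsD unfolding dmap_def by blast
      with True show ?thesis by auto
    next
      case False
      then show ?thesis using A x X unfolding closed_within_def by blast
    qed
    then obtain d where d: "d > 0" "\<And>y. y \<in> A \<Longrightarrow> close m d x y \<Longrightarrow> close k e (?h x) (?h y)"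
      by blast
    have hg: "?h y = g y" if "y \<in> B" for y using that eq by auto
    have "\<exists>d>0. \<forall>y\<in>B. close m d x y \<longrightarrow> close k e (?h x) (?h y)"
    proof (cases "x \<in> B")
      case True
      then obtain d where "d > 0" "\<And>y. y \<in> B \<Longrightarrow> close m d x y \<Longrightarrow> close k e (g x) (g y)"
        using g e continuous_coordsD unfolding dmap_def by blast
      then show ?thesis using hg True by (intro exI[of _ d]) (simp del: if_split)
    next
      case False
      then show ?thesis using B x X unfolding closed_within_def by blast
    qed
    then obtain d' where d': "d' > 0" "\<And>y. y \<in> B \<Longrightarrow> close m d' x y \<Longrightarrow> close k e (?h x) (?h y)"
      by blast
    have "close k e (?h x) (?h y)" if y: "y \<in> X" "close m (min d d') x y" for y
    proof (cases "y \<in> A")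
      case True
      then show ?thesis by (rule d(2)) (rule close_mono[OF y(2)], simp)
    next
      case False
      then have "y \<in> B" using y X by auto
      then show ?thesis by (rule d'(2)) (rule close_mono[OF y(2)], simp)
    qed
    moreover have "min d d' > 0" using d(1) d'(1) by simp
    ultimately show "\<exists>d>0. \<forall>y\<in>X. close m d x y \<longrightarrow> close k e (?h x) (?h y)" by blast
  qed
  ultimately show ?thesis by (simp add: dmap_def)
qed

section \<open>Scalar functions built from coordinates and constants\<close>

abbreviation dfun ::
  "('a::linordered_field, 'f, 'r) expansion \<Rightarrow> nat \<Rightarrow> 'a list set \<Rightarrow> ('a list \<Rightarrow> 'a) \<Rightarrow> bool" where
  "dfun R m X g \<equiv> dmap R m X 1 (\<lambda>x. [g x])"

lemma dmap_const:
  assumes "definable R m X"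
  shows "dmap R m X (length c) (\<lambda>_. c)"
proof (rule dmapI)
  have 1: "definable R (m + length c) {w. length w = m + length c \<and> map ((!) w) [0..<m] \<in> X}"
    using assms by (intro definable_reindex) auto
  have "definable R (m + length c) {w \<in> {w. length w = m + length c}. \<forall>i<length c. w ! (m + i) = c ! i}"
  proof (intro definable_Ball definable_all)
    fix i assume "i < length c"
    then have "definable R (m + length c) {w. length w = m + length c \<and> w ! (m + i) = c ! i}"
      by (intro definable_Collect[where \<phi> = "Equal (Var (m + i)) (Const (c ! i))"])
        (simp add: assignment_def)
    then show "definable R (m + length c) {w \<in> {w. length w = m + length c}. w ! (m + i) = c ! i}"
      by simp
  qed
  note 2 = definable_Int[OF 1 this]
  have eqv: "(\<forall>i<length c. w ! (m + i) = c ! i) \<longleftrightarrow> c = drop m w" if "length w = m + length c" for w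
  proof
    assume "\<forall>i<length c. w ! (m + i) = c ! i"
    then show "c = drop m w" using that by (intro nth_equalityI) auto
  qed (use that in auto)
  have "{w. length w = m + length c \<and> map ((!) w) [0..<m] \<in> X} \<inter>
      {w \<in> {w. length w = m + length c}. \<forall>i<length c. w ! (m + i) = c ! i} =
      {w. length w = m + length c \<and> take m w \<in> X \<and> c = drop m w}" (is "?A = ?B")
  proof (rule Set.set_eqI)
    show "w \<in> ?A \<longleftrightarrow> w \<in> ?B" for w
      by (cases "length w = m + length c") (simp_all add: eqv map_nth_upt)
  qed
  with 2 show "definable R (m + length c) {w. length w = m + length c \<and> take m w \<in> X \<and> c = drop m w}"
    by simp
  show "continuous_coords m X (length c) (\<lambda>_. c)"
    unfolding continuous_coords_def using zero_less_one close_refl by blast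
qed (use assms in auto)

lemma dfun_const: "definable R m X \<Longrightarrow> dfun R m X (\<lambda>_. c)"
  using dmap_const[of R m X "[c]"] by simp

lemma dfun_nth:
  assumes "definable R m X" "i < m"
  shows "dfun R m X (\<lambda>x. x ! i)"
proof (rule dmapI)
  have 1: "definable R (m + 1) {w. length w = m + 1 \<and> map ((!) w) [0..<m] \<in> X}"
    using assms by (intro definable_reindex) auto
  have "definable R (m + 1) {w. length w = m + 1 \<and> w ! i = w ! m}"
    using assms(2) by (intro definable_Collect[where \<phi> = "Equal (Var i) (Var m)"])
        (simp add: assignment_def)
  from definable_Int[OF 1 this]
  show "definable R (m + 1) {w. length w = m + 1 \<and> take m w \<in> X \<and> [take m w ! i] = drop m w}"
    by (rule back_subst) (use assms(2) in \<open>auto simp: map_nth_upt list_eq_iff_nth_eq\<close>)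
  show "continuous_coords m X 1 (\<lambda>x. [x ! i])"
    unfolding continuous_coords_def using assms(2) by (auto simp: close_def)
qed (use assms in auto)

lemma dmap_coords:
  assumes X: "definable R m X" and g: "\<And>i. i < k \<Longrightarrow> dfun R m X (g i)"
    and len: "\<And>x. x \<in> X \<Longrightarrow> length (f x) = k"
    and eq: "\<And>x i. x \<in> X \<Longrightarrow> i < k \<Longrightarrow> f x ! i = g i x"
  shows "dmap R m X k f"
proof (rule dmap_cong)
  show "dmap R m X k (\<lambda>x. map (\<lambda>i. g i x) [0..<k])"
    using g
  proof (induction k)
    case 0
    show ?case using dmap_const[OF X, of "[]"] by simp
  next
    case (Suc k)
    then have "dmap R m X (k + 1) (\<lambda>x. map (\<lambda>i. g i x) [0..<k] @ [g k x])"
      by (intro dmap_append) auto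
    then show ?case by simp
  qed
  show "map (\<lambda>i. g i x) [0..<k] = f x" if "x \<in> X" for x
    using that len eq by (auto intro!: nth_equalityI)
qed

lemma dmap_take:
  assumes "definable R m X" "n \<le> m"
  shows "dmap R m X n (take n)"
proof (rule dmap_coords)
  show "dfun R m X (\<lambda>x. x ! i)" if "i < n" for i
    using that assms by (intro dfun_nth) auto
qed (use assms definable_length[OF assms(1)] in auto)

lemma dmap_pair:
  assumes "dfun R m X g" "dfun R m X h"
  shows "dmap R m X 2 (\<lambda>x. [g x, h x])"
  using dmap_append[OF assms] by (simp add: numeral_2_eq_2)

text \<open>The operation becomes a map on the plane and is composed with the pair (g, h). What
  remains for each operation is a formula for its graph and continuity in two variables.\<close>

lemma dfun_binop:
  fixes op :: "'a::linordered_field \<Rightarrow> 'a \<Rightarrow> 'a"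
  assumes g: "dfun R m X g" and h: "dfun R m X h"
    and def: "definable R 3 {w. length w = 3 \<and> op (w ! 0) (w ! 1) = w ! 2}"
    and cont: "\<And>a b e. e > 0 \<Longrightarrow> \<exists>d>0. \<forall>a' b'. \<bar>a - a'\<bar> < d \<and> \<bar>b - b'\<bar> < d \<longrightarrow> \<bar>op a b - op a' b'\<bar> < e"
  shows "dfun R m X (\<lambda>x. op (g x) (h x))"
proof -
  have "dfun R 2 {y. length y = 2} (\<lambda>y. op (y ! 0) (y ! 1))"
  proof (rule dmapI)
    have "[op (take 2 w ! 0) (take 2 w ! 1)] = drop 2 w \<longleftrightarrow> op (w ! 0) (w ! 1) = w ! 2"
      if "length w = 3" for w
      using that by (simp add: list_eq_iff_nth_eq)
    then have "{w. length w = 2 + 1 \<and> take 2 w \<in> {y. length y = 2} \<and>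
        [op (take 2 w ! 0) (take 2 w ! 1)] = drop 2 w} =
        {w. length w = 3 \<and> op (w ! 0) (w ! 1) = w ! 2}" by auto
    then show "definable R (2 + 1) {w. length w = 2 + 1 \<and> take 2 w \<in> {y. length y = 2} \<and>
        [op (take 2 w ! 0) (take 2 w ! 1)] = drop 2 w}"
      using def by simp
    show "continuous_coords 2 {y. length y = 2} 1 (\<lambda>y. [op (y ! 0) (y ! 1)])"
      unfolding continuous_coords_def
    proof (intro ballI allI impI)
      fix x :: "'a list" and e :: 'a assume "e > 0"
      then obtain d where d: "d > 0" "\<forall>a' b'. \<bar>x ! 0 - a'\<bar> < d \<and> \<bar>x ! 1 - b'\<bar> < d \<longrightarrow>
          \<bar>op (x ! 0) (x ! 1) - op a' b'\<bar> < e"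
        using cont by blast
      have "close 1 e [op (x ! 0) (x ! 1)] [op (y ! 0) (y ! 1)]" if "close 2 d x y" for y
        using closeD[OF that, of 0] closeD[OF that, of 1] d(2) by (simp add: close_def)
      with d(1) show "\<exists>d>0. \<forall>y\<in>{y. length y = 2}. close 2 d x y \<longrightarrow>
          close 1 e [op (x ! 0) (x ! 1)] [op (y ! 0) (y ! 1)]" by blast
    qed
  qed (auto intro: definable_all)
  from dmap_compose[OF dmap_pair[OF g h] this] show ?thesis by simp
qed

lemma dfun_add:
  assumes "dfun R m X g" "dfun R m X h"
  shows "dfun R m X (\<lambda>x. g x + h x)"
proof (rule dfun_binop[OF assms])
  show "definable R 3 {w. length w = 3 \<and> w ! 0 + w ! 1 = w ! 2}"
    by (rule definable_Collect[where \<phi> = "Equal (Plus (Var 0) (Var 1)) (Var 2)"])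
      (simp add: assignment_def)
  fix a b e :: 'a assume "e > 0"
  moreover have "\<bar>a + b - (a' + b')\<bar> < e" if "\<bar>a - a'\<bar> < e / 2" "\<bar>b - b'\<bar> < e / 2" for a' b'
    using that by linarith
  ultimately show "\<exists>d>0. \<forall>a' b'. \<bar>a - a'\<bar> < d \<and> \<bar>b - b'\<bar> < d \<longrightarrow> \<bar>a + b - (a' + b')\<bar> < e"
    by (intro exI[of _ "e / 2"]) simp
qed

lemma dfun_diff:
  assumes "dfun R m X g" "dfun R m X h"
  shows "dfun R m X (\<lambda>x. g x - h x)"
proof (rule dfun_binop[OF assms])
  show "definable R 3 {w. length w = 3 \<and> w ! 0 - w ! 1 = w ! 2}"
    by (rule definable_Collect[where \<phi> = "Equal (Plus (Var 0) (Minus (Var 1))) (Var 2)"])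
      (simp add: assignment_def)
  fix a b e :: 'a assume "e > 0"
  moreover have "\<bar>a - b - (a' - b')\<bar> < e" if "\<bar>a - a'\<bar> < e / 2" "\<bar>b - b'\<bar> < e / 2" for a' b'
    using that by linarith
  ultimately show "\<exists>d>0. \<forall>a' b'. \<bar>a - a'\<bar> < d \<and> \<bar>b - b'\<bar> < d \<longrightarrow> \<bar>a - b - (a' - b')\<bar> < e"
    by (intro exI[of _ "e / 2"]) simp
qed

lemma dfun_min:
  assumes "dfun R m X g" "dfun R m X h"
  shows "dfun R m X (\<lambda>x. min (g x) (h x))"
proof (rule dfun_binop[OF assms])
  show "definable R 3 {w. length w = 3 \<and> min (w ! 0) (w ! 1) = w ! 2}"
    \<comment> \<open>The formulas have no disjunction, so the two cases of the minimum are joined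
      by De Morgan's law.\<close>
    by (rule definable_Collect[where \<phi> = "Neg (Conj (Neg (Conj (Neg (Less (Var 1) (Var 0))) (Equal (Var 0) (Var 2))))
      (Neg (Conj (Less (Var 1) (Var 0)) (Equal (Var 1) (Var 2)))))"])
      (auto simp: assignment_def min_def)
  fix a b e :: 'a assume "e > 0"
  then show "\<exists>d>0. \<forall>a' b'. \<bar>a - a'\<bar> < d \<and> \<bar>b - b'\<bar> < d \<longrightarrow> \<bar>min a b - min a' b'\<bar> < e"
    by (intro exI[of _ e]) (auto simp: abs_less_iff min_def)
qed

lemma dfun_max:
  assumes "dfun R m X g" "dfun R m X h"
  shows "dfun R m X (\<lambda>x. max (g x) (h x))"
proof (rule dfun_binop[OF assms])
  show "definable R 3 {w. length w = 3 \<and> max (w ! 0) (w ! 1) = w ! 2}"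
    by (rule definable_Collect[where \<phi> = "Neg (Conj (Neg (Conj (Neg (Less (Var 0) (Var 1))) (Equal (Var 0) (Var 2))))
      (Neg (Conj (Less (Var 0) (Var 1)) (Equal (Var 1) (Var 2)))))"])
      (auto simp: assignment_def max_def)
  fix a b e :: 'a assume "e > 0"
  then show "\<exists>d>0. \<forall>a' b'. \<bar>a - a'\<bar> < d \<and> \<bar>b - b'\<bar> < d \<longrightarrow> \<bar>max a b - max a' b'\<bar> < e"
    by (intro exI[of _ e]) (auto simp: abs_less_iff max_def)
qed

lemma dfun_mult:
  fixes g h :: "'a::linordered_field list \<Rightarrow> 'a"
  assumes "dfun R m X g" "dfun R m X h"
  shows "dfun R m X (\<lambda>x. g x * h x)"
proof (rule dfun_binop[OF assms])
  show "definable R 3 {w. length w = 3 \<and> w ! 0 * w ! 1 = w ! 2}"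
    by (rule definable_Collect[where \<phi> = "Equal (Times (Var 0) (Var 1)) (Var 2)"])
      (simp add: assignment_def)
  fix a b e :: 'a assume e: "e > 0"
  \<comment> \<open>The difference of products is (a - a') b' + a (b - b'). As d is at most 1, |b'|
    is at most |b| + 1, so the bound is d (|b| + 1) + |a| d, which is d D.\<close>
  define D where "D = \<bar>a\<bar> + \<bar>b\<bar> + 1"
  have D: "D > 0" unfolding D_def by (simp add: add_nonneg_pos)
  define d where "d = min 1 (e / D)"
  have "\<bar>a * b - a' * b'\<bar> < e" if "\<bar>a - a'\<bar> < d" "\<bar>b - b'\<bar> < d" for a' b'
  proof -
    have d: "d > 0" "d \<le> 1" "d * D \<le> e"
      using D e by (auto simp: d_def min_mult_distrib_right min_le_iff_disj)
    have "a * b - a' * b' = (a - a') * b' + a * (b - b')" by (simp add: algebra_simps)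
    then have "\<bar>a * b - a' * b'\<bar> \<le> \<bar>a - a'\<bar> * \<bar>b'\<bar> + \<bar>a\<bar> * \<bar>b - b'\<bar>"
      by (metis abs_mult abs_triangle_ineq)
    also have "\<dots> \<le> \<bar>a - a'\<bar> * (\<bar>b\<bar> + 1) + \<bar>a\<bar> * d"
      using that d by (intro add_mono mult_left_mono) auto
    also have "\<dots> < d * (\<bar>b\<bar> + 1) + \<bar>a\<bar> * d"
      using that d by (intro add_strict_right_mono mult_strict_right_mono) (auto simp: add_nonneg_pos)
    also have "\<dots> = d * D" by (simp add: D_def algebra_simps)
    finally show ?thesis using d(3) by simp
  qed
  moreover have "d > 0" using D e by (simp add: d_def)
  ultimately show "\<exists>d>0. \<forall>a' b'. \<bar>a - a'\<bar> < d \<and> \<bar>b - b'\<bar> < d \<longrightarrow> \<bar>a * b - a' * b'\<bar> < e"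
    by blast
qed

section \<open>Sets cut out by equations and inequalities\<close>

lemma definable_le:
  assumes "dfun R m X g" "dfun R m X h"
  shows "definable R m {x \<in> X. g x \<le> h x}"
proof -
  have "definable R 2 {w. length w = 2 \<and> w ! 0 \<le> w ! 1}"
    by (rule definable_Collect[where \<phi> = "Neg (Less (Var 1) (Var 0))"]) (auto simp: assignment_def)
  from definable_vimage[OF dmap_pair[OF assms] this] show ?thesis by simp
qed

lemma definable_eq:
  assumes "dfun R m X g" "dfun R m X h"
  shows "definable R m {x \<in> X. g x = h x}"
proof -
  have "definable R 2 {w. length w = 2 \<and> w ! 0 = w ! 1}"
    by (rule definable_Collect[where \<phi> = "Equal (Var 0) (Var 1)"]) (auto simp: assignment_def)
  from definable_vimage[OF dmap_pair[OF assms] this] show ?thesis by simp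
qed

text \<open>At a point where g exceeds h, the difference itself serves as epsilon: it stays positive
  nearby.\<close>

lemma closed_within_le:
  fixes g h :: "'a::linordered_field list \<Rightarrow> 'a"
  assumes "dfun R m X g" "dfun R m X h"
  shows "closed_within m X {x \<in> X. g x \<le> h x}"
  unfolding closed_within_def
proof
  fix x assume "x \<in> X - {x \<in> X. g x \<le> h x}"
  then have x: "x \<in> X" "g x - h x > 0" by auto
  have "continuous_coords m X 1 (\<lambda>x. [g x - h x])"
    using dfun_diff[OF assms] by (simp add: dmap_def)
  then obtain d where d: "d > 0"
    "\<And>y. y \<in> X \<Longrightarrow> close m d x y \<Longrightarrow> close 1 (g x - h x) [g x - h x] [g y - h y]"
    using x continuous_coordsD by blast
  have "y \<notin> {x \<in> X. g x \<le> h x}" if "y \<in> X" "close m d x y" for y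
    using d(2)[OF that] by (auto simp: close_def abs_less_iff)
  with d(1) show "\<exists>d>0. \<forall>y\<in>X. close m d x y \<longrightarrow> y \<notin> {x \<in> X. g x \<le> h x}" by blast
qed

lemma closed_within_Int:
  assumes "closed_within m X A" "closed_within m X B"
  shows "closed_within m X (A \<inter> B)"
  using assms unfolding closed_within_def by blast

lemma closed_within_Un:
  assumes "closed_within m X A" "closed_within m X B"
  shows "closed_within m X (A \<union> B)"
  unfolding closed_within_def
proof
  fix x assume "x \<in> X - (A \<union> B)"
  then have x: "x \<in> X - A" "x \<in> X - B" by auto
  obtain d where d: "d > 0" "\<And>y. y \<in> X \<Longrightarrow> close m d x y \<Longrightarrow> y \<notin> A"
    using assms(1) x(1) unfolding closed_within_def by blast
  obtain d' where d': "d' > 0" "\<And>y. y \<in> X \<Longrightarrow> close m d' x y \<Longrightarrow> y \<notin> B"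
    using assms(2) x(2) unfolding closed_within_def by blast
  have "y \<notin> A \<union> B" if "y \<in> X" "close m (min d d') x y" for y
    using d(2)[OF that(1) close_mono[OF that(2)]] d'(2)[OF that(1) close_mono[OF that(2)]] by simp
  moreover have "min d d' > 0" using d(1) d'(1) by simp
  ultimately show "\<exists>d>0. \<forall>y\<in>X. close m d x y \<longrightarrow> y \<notin> A \<union> B" by blast
qed

lemma closed_within_eq:
  assumes "dfun R m X g" "dfun R m X h"
  shows "closed_within m X {x \<in> X. g x = h x}"
proof -
  have "{x \<in> X. g x = h x} = {x \<in> X. g x \<le> h x} \<inter> {x \<in> X. h x \<le> g x}" by auto
  then show ?thesis using assms by (simp add: closed_within_Int closed_within_le)
qed

lemma closed_within_Bex:
  fixes k :: nat
  assumes "\<And>i. i < k \<Longrightarrow> closed_within m X {x \<in> X. P i x}"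
  shows "closed_within m X {x \<in> X. \<exists>i<k. P i x}"
  using assms
proof (induction k)
  case 0
  show ?case by (auto simp: closed_within_def intro: exI[of _ 1])
next
  case (Suc k)
  have "{x \<in> X. \<exists>i<Suc k. P i x} = {x \<in> X. \<exists>i<k. P i x} \<union> {x \<in> X. P k x}"
    by (auto simp: less_Suc_eq)
  then show ?case using Suc by (simp add: closed_within_Un)
qed

lemma closed_within_subset:
  "closed_within m X A \<Longrightarrow> Y \<subseteq> X \<Longrightarrow> closed_within m Y (A \<inter> Y)"
  unfolding closed_within_def by blast

subsection \<open>Cubes\<close>

lemma mem_cube:
  "x \<in> cube n \<longleftrightarrow> length x = n \<and> (\<forall>i<n. 0 \<le> x ! i \<and> x ! i \<le> 1)"
  by (auto simp: cube_def in_set_conv_nth subset_iff)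

lemma cubeD: "x \<in> cube n \<Longrightarrow> i < n \<Longrightarrow> 0 \<le> x ! i \<and> x ! i \<le> 1"
  by (simp add: mem_cube)

lemma cube_length: "x \<in> cube n \<Longrightarrow> length x = n"
  by (simp add: mem_cube)

lemma snoc_mem_cube: "x @ [s] \<in> cube (Suc n) \<longleftrightarrow> x \<in> cube n \<and> 0 \<le> s \<and> s \<le> 1"
  by (auto simp: cube_def)

lemma times_I_cube: "times_I (cube n) = cube (n + 1)"
proof (rule Set.set_eqI)
  fix z :: "'a list"
  show "z \<in> times_I (cube n) \<longleftrightarrow> z \<in> cube (n + 1)"
  proof (cases z rule: rev_cases)
    case Nil
    then show ?thesis by (simp add: times_I_def cube_def)
  next
    case (snoc x s)
    then show ?thesis by (auto simp: times_I_def snoc_mem_cube)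
  qed
qed

lemma definable_cube: "definable R n (cube n)"
proof -
  have "cube n = {x \<in> {x. length x = n}. \<forall>i<n. 0 \<le> x ! i} \<inter>
      {x \<in> {x. length x = n}. \<forall>i<n. x ! i \<le> (1::'a)}"
    by (auto simp: mem_cube)
  moreover have "definable R n {x \<in> {x. length x = n}. \<forall>i<n. 0 \<le> x ! i}"
    by (intro definable_Ball definable_all definable_le dfun_nth dfun_const)
  moreover have "definable R n {x \<in> {x. length x = n}. \<forall>i<n. x ! i \<le> 1}"
    by (intro definable_Ball definable_all definable_le dfun_nth dfun_const)
  ultimately show ?thesis by (simp only: definable_Int)
qed

lemma closed_bounded_cube: "closed_bounded n (cube n)"
proof -
  have "x \<in> cube n" if x: "length x = n" "\<forall>e>0. \<exists>y\<in>cube n. close n e x y" for x :: "'a list"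
  proof -
    have "0 \<le> x ! i \<and> x ! i \<le> 1" if i: "i < n" for i
    proof (rule ccontr)
      assume "\<not> (0 \<le> x ! i \<and> x ! i \<le> 1)"
      \<comment> \<open>This maximum is the distance from the coordinate to the unit interval, so no
        point of the cube can be that close.\<close>
      then have "max (- (x ! i)) (x ! i - 1) > 0" by (auto simp: less_max_iff_disj)
      then obtain y where y: "y \<in> cube n" "close n (max (- (x ! i)) (x ! i - 1)) x y"
        using x by blast
      then show False
        using closeD[OF y(2) i] cubeD[OF y(1) i] by (auto simp: max_def abs_less_iff split: if_splits)
    qed
    with x show ?thesis by (simp add: mem_cube)
  qed
  then have "Rn n closure_of (cube n :: 'a list set) \<subseteq> cube n"
    by (subst closure_of_Rn) (auto simp: cube_length)
  then have "closedin (Rn n) (cube n :: 'a list set)"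
    by (auto simp: closure_of_subset_eq[symmetric] topspace_Rn cube_length)
  moreover have "\<forall>x\<in>cube n. \<forall>i<n. \<bar>x ! i\<bar> \<le> (1::'a)"
    by (auto simp: mem_cube)
  ultimately show ?thesis unfolding closed_bounded_def by blast
qed

lemma cube_boundary_eq:
  "cube_boundary n = {x \<in> cube n. \<exists>i<n. x ! i = 0 \<or> x ! i = (1::'a::linordered_field)}"
proof -
  have cl: "Rn n closure_of (cube n :: 'a list set) = cube n"
    using closed_bounded_cube closure_of_closedin unfolding closed_bounded_def by blast
  have "x \<in> Rn n closure_of (topspace (Rn n) - cube n) \<longleftrightarrow> (\<exists>i<n. x ! i = 0 \<or> x ! i = 1)"
    if x: "x \<in> cube n" for x :: "'a list"
  proof
    assume L: "x \<in> Rn n closure_of (topspace (Rn n) - cube n)"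
    show "\<exists>i<n. x ! i = 0 \<or> x ! i = 1"
    proof (rule ccontr)
      assume "\<not> (\<exists>i<n. x ! i = 0 \<or> x ! i = 1)"
      then have "0 < min (x ! i) (1 - x ! i)" if "i < n" for i
        using that cubeD[OF x that] by (auto simp: less_le)
      then obtain e where e: "e > 0" "\<And>i. i < n \<Longrightarrow> e \<le> min (x ! i) (1 - x ! i)"
        using finite_pos_lower_bound[of n "\<lambda>i. min (x ! i) (1 - x ! i)"] by blast
      obtain y where y: "length y = n" "y \<notin> cube n" "close n e x y"
        using L e(1) by (subst (asm) closure_of_Rn) (auto simp: topspace_Rn)
      have "0 \<le> y ! i \<and> y ! i \<le> 1" if "i < n" for i
        using closeD[OF y(3) that] e(2)[OF that] by (auto simp: abs_less_iff)
      with y show False by (simp add: mem_cube)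
    qed
  next
    assume "\<exists>i<n. x ! i = 0 \<or> x ! i = 1"
    then obtain i where i: "i < n" "x ! i = 0 \<or> x ! i = 1" by blast
    have "\<exists>y\<in>topspace (Rn n) - cube n. close n e x y" if e: "e > 0" for e
    proof -
      \<comment> \<open>Moving the extreme coordinate outwards by half of e leaves the cube but
        stays within e.\<close>
      define c where "c = (if x ! i = 0 then - (e / 2) else 1 + e / 2)"
      have "x[i := c] \<notin> cube n"
        using i e cubeD[of "x[i := c]" n i] x by (auto simp: c_def cube_length)
      moreover have "close n e x (x[i := c])"
        using i e x by (auto simp: close_def nth_list_update cube_length c_def)
      ultimately show ?thesis using x
        by (intro bexI[of _ "x[i := c]"]) (auto simp: topspace_Rn cube_length)
    qed
    then show "x \<in> Rn n closure_of (topspace (Rn n) - cube n)"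
      using x by (subst closure_of_Rn) (auto simp: topspace_Rn cube_length)
  qed
  then show ?thesis
    unfolding cube_boundary_def frontier_of_closures cl by blast
qed

lemma cube_face_eq: "0 < n \<Longrightarrow> cube_face n = {x \<in> cube n. x ! (n - 1) = 0}"
  by (auto simp: cube_face_def mem_cube last_conv_nth)

text \<open>
  \<open>cube_J n\<close> is \<open>horn n (n - 1)\<close>; in dimension \<open>n + 1\<close>, lifting homotopies needs \<open>horn (n + 1) (n - 1)\<close>.
\<close>

definition horn :: "nat \<Rightarrow> nat \<Rightarrow> 'a::linordered_field list set" where
  "horn n j = {x \<in> cube n. x ! j = 1 \<or> (\<exists>i<n. i \<noteq> j \<and> (x ! i = 0 \<or> x ! i = 1))}"

lemma horn_subset_cube: "horn n j \<subseteq> cube n"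
  by (auto simp: horn_def)

text \<open>The index bound m is kept apart from the dimension n, and X is arbitrary, because the
  same condition is used twice: with m = n on a cube for the horn itself, and for the first n
  coordinates of points in dimension n + 1 when homotopies are lifted.\<close>

lemma
  assumes X: "definable R n X" and j: "j < n"
  shows definable_horn_cond:
      "definable R n {x \<in> X. x ! j = 1 \<or> (\<exists>i<m. i \<noteq> j \<and> i < n \<and> (x ! i = 0 \<or> x ! i = 1))}" (is ?D)
    and closed_within_horn_cond:
      "closed_within n X {x \<in> X. x ! j = 1 \<or> (\<exists>i<m. i \<noteq> j \<and> i < n \<and> (x ! i = 0 \<or> x ! i = 1))}" (is ?C)
proof -
  have eqD: "definable R n {x \<in> X. x ! i = c}" if "i < n" for i c
    using that X by (intro definable_eq dfun_nth dfun_const)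
  have eqC: "closed_within n X {x \<in> X. x ! i = c}" if "i < n" for i c
    using that X by (intro closed_within_eq dfun_nth dfun_const)
  have empty: "definable R n {}" using definable_Diff[OF X X] by simp
  have "definable R n {x \<in> X. i \<noteq> j \<and> i < n \<and> (x ! i = 0 \<or> x ! i = 1)}" for i
    using definable_disj[OF eqD eqD, of i i 0 1] empty by (cases "i \<noteq> j \<and> i < n") auto
  with X j show ?D by (intro definable_disj definable_Bex eqD)
  have "closed_within n X {x \<in> X. i \<noteq> j \<and> i < n \<and> (x ! i = 0 \<or> x ! i = 1)}" for i
  proof (cases "i \<noteq> j \<and> i < n")
    case True
    then have "{x \<in> X. i \<noteq> j \<and> i < n \<and> (x ! i = 0 \<or> x ! i = 1)} = {x \<in> X. x ! i = 0} \<union> {x \<in> X. x ! i = 1}"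
      by auto
    then show ?thesis using True eqC by (simp add: closed_within_Un)
  next
    case False
    then show ?thesis by (auto simp: closed_within_def intro: exI[of _ 1])
  qed
  then have "closed_within n X ({x \<in> X. x ! j = 1} \<union>
      {x \<in> X. \<exists>i<m. i \<noteq> j \<and> i < n \<and> (x ! i = 0 \<or> x ! i = 1)})"
    using j by (intro closed_within_Un closed_within_Bex eqC)
  then show ?C by (simp add: Collect_disj_eq[symmetric] conj_disj_distribL)
qed

lemma definable_horn: "j < n \<Longrightarrow> definable R n (horn n j)"
  using definable_horn_cond[OF definable_cube, of j n R n]
  by (simp add: horn_def cong: conj_cong)

text \<open>The closure puts back the rim of the removed face: if the last coordinate is 0 and
  another one is extreme, a slight increase of the last coordinate leads to a boundary point off the
  face. Nothing else is added, since the horn is closed.\<close>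

lemma cube_J_eq:
  assumes n: "0 < n"
  shows "cube_J n = (horn n (n - 1) :: 'a::linordered_field list set)"
proof -
  let ?S = "cube_boundary n - cube_face n :: 'a list set"
  have S: "?S = {x \<in> cube n. x ! (n - 1) \<noteq> 0 \<and> (\<exists>i<n. x ! i = 0 \<or> x ! i = 1)}"
    using n by (auto simp: cube_boundary_eq cube_face_eq)
  have "x \<in> Rn n closure_of ?S \<longleftrightarrow> x \<in> horn n (n - 1)" for x :: "'a list"
  proof
    assume "x \<in> horn n (n - 1)"
    then have x: "x \<in> cube n" "x ! (n - 1) = 1 \<or> (\<exists>i<n. i \<noteq> n - 1 \<and> (x ! i = 0 \<or> x ! i = 1))"
      by (auto simp: horn_def)
    have "\<exists>y\<in>?S. close n e x y" if e: "e > 0" for e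
    proof (cases "x ! (n - 1) = 0")
      case False
      then have "x \<in> ?S" unfolding S using x n by (auto intro: exI[of _ "n - 1"])
      then show ?thesis using e close_refl by blast
    next
      case True
      then obtain i where i: "i < n" "i \<noteq> n - 1" "x ! i = 0 \<or> x ! i = 1" using x(2) by auto
      define c where "c = min (e / 2) 1"
      have c: "0 < c" "c \<le> 1" "c < e" using e by (auto simp: c_def min_less_iff_disj)
      have "x[n - 1 := c] \<in> ?S"
        unfolding S using x(1) c i n by (auto simp: mem_cube nth_list_update intro!: exI[of _ i])
      moreover have "close n e x (x[n - 1 := c])"
        using True c e x(1) by (auto simp: close_def nth_list_update cube_length)
      ultimately show ?thesis by blast
    qed
    then show "x \<in> Rn n closure_of ?S"
      using x(1) by (subst closure_of_Rn) (auto simp: S cube_length)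
  next
    assume "x \<in> Rn n closure_of ?S"
    then have x: "length x = n" "\<forall>e>0. \<exists>y\<in>?S. close n e x y"
      by (subst (asm) closure_of_Rn; auto simp: S cube_length)+
    have sub: "?S \<subseteq> horn n (n - 1)"
      using n unfolding S horn_def by auto
    have "x \<in> Rn n closure_of cube n"
      using x sub horn_subset_cube by (subst closure_of_Rn) (auto simp: cube_length, blast)
    then have xc: "x \<in> cube n"
      using closed_bounded_cube closure_of_closedin unfolding closed_bounded_def by blast
    \<comment> \<open>Closedness does not mention an expansion, while the lemma on horn conditions
      speaks of definable sets. Cubes are definable in every expansion, so an arbitrary one is
      supplied.\<close>
    have "closed_within n (cube n) (horn n (n - 1) :: 'a list set)"
      using closed_within_horn_cond[OF definable_cube[of "undefined :: ('a, unit, unit) expansion"],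
          of "n - 1" n n] n
      by (simp add: horn_def cong: conj_cong)
    then show "x \<in> horn n (n - 1)"
      using x(2) xc sub horn_subset_cube unfolding closed_within_def by (meson DiffI subsetD)
  qed
  then show ?thesis unfolding cube_J_def by blast
qed

lemma cube_boundary_eq_face_Un_J: "0 < n \<Longrightarrow> cube_boundary n = cube_face n \<union> cube_J n"
  by (auto simp: cube_boundary_eq cube_face_eq cube_J_eq horn_def intro: exI[of _ "n - 1"])

text \<open>\<open>rel_maps\<close> requires the image of \<open>cube_J n\<close> to be the whole
  singleton; a point of \<open>cube_J n\<close> is what turns this into a pointwise
  condition.\<close>

lemma cube_J_nonempty:
  assumes "0 < n"
  shows "replicate n 1 \<in> cube_J n"
  using assms by (auto simp: cube_J_eq horn_def mem_cube)

subsection \<open>Lifting relative to a horn\<close>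

text \<open>For a point of the cube, the distance to the faces in the directions other than j. The
  initial value 1/2 is the largest distance that can occur, so it is felt only when no other
  direction exists (n = 1). The recursion lets definability and continuity be proved by
  induction.\<close>

primrec side_dist :: "nat \<Rightarrow> 'a::linordered_field list \<Rightarrow> nat \<Rightarrow> 'a" where
  "side_dist j x 0 = 1 / 2"
| "side_dist j x (Suc i) =
     (if i = j then side_dist j x i else min (side_dist j x i) (min (x ! i) (1 - x ! i)))"

text \<open>
  \<open>push_out\<close> stretches the other coordinates away from the centre and raises coordinate \<open>j\<close>, clamping
  everything to the cube. \<open>exit_time\<close> is only an upper bound for the time at which the horn is reached;
  a clamped coordinate keeps the point in the horn afterwards.
\<close>

definition exit_time :: "nat \<Rightarrow> nat \<Rightarrow> 'a::linordered_field list \<Rightarrow> 'a" where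
  "exit_time n j x = 2 * min (side_dist j x n) (1 - x ! j)"

definition push_out :: "nat \<Rightarrow> nat \<Rightarrow> 'a::linordered_field \<Rightarrow> 'a list \<Rightarrow> 'a list" where
  "push_out n j s x = map (\<lambda>i.
     if i = j then min 1 (x ! j + 2 * s)
     else max 0 (min 1 (1 / 2 + (1 + 2 * s) * (x ! i - 1 / 2)))) [0..<n]"

lemma side_dist_cong: "(\<And>i. i < n \<Longrightarrow> x ! i = y ! i) \<Longrightarrow> side_dist j x n = side_dist j y n"
  by (induction n) auto

text \<open>Only the first n entries are read, so the functions may be applied directly to a point
  (x, s) of the cylinder.\<close>

lemma exit_time_snoc:
  "length x = n \<Longrightarrow> j < n \<Longrightarrow> exit_time n j (x @ [s]) = exit_time n j x"
  using side_dist_cong[of n "x @ [s]" x j] by (simp add: exit_time_def nth_append)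

lemma push_out_snoc:
  "length x = n \<Longrightarrow> j < n \<Longrightarrow> push_out n j t (x @ [s]) = push_out n j t x"
  by (simp add: push_out_def nth_append)

lemma side_dist_le: "i < n \<Longrightarrow> i \<noteq> j \<Longrightarrow> side_dist j x n \<le> min (x ! i) (1 - x ! i)"
  by (induction n) (auto simp: less_Suc_eq min_le_iff_disj)

lemma side_dist_le_half: "side_dist j x n \<le> 1 / 2"
  by (induction n) (auto intro: min.coboundedI1 simp del: le_divide_eq_numeral1)

lemma side_dist_nonneg: "(\<And>i. i < n \<Longrightarrow> 0 \<le> x ! i \<and> x ! i \<le> 1) \<Longrightarrow> 0 \<le> side_dist j x n"
  by (induction n) auto

text \<open>A value below 1/2 cannot be the initial value of the recursion, so some coordinate must
  supply it.\<close>

lemma side_dist_attained: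
  "side_dist j x n < 1 / 2 \<Longrightarrow> \<exists>i<n. i \<noteq> j \<and> side_dist j x n = min (x ! i) (1 - x ! i)"
proof (induction n)
  case (Suc n)
  show ?case
  proof (cases "n = j \<or> side_dist j x n \<le> min (x ! n) (1 - x ! n)")
    case True
    then have "side_dist j x (Suc n) = side_dist j x n" by auto
    with Suc show ?thesis using less_SucI by metis
  next
    case False
    then have "side_dist j x (Suc n) = min (x ! n) (1 - x ! n)" by auto
    with False show ?thesis by blast
  qed
qed simp

text \<open>The initial value 1/2 of \<open>side_dist\<close> and the factor 2 in
  \<open>exit_time\<close> are matched: together they keep the time in the unit interval, so that
  the point (x, \<open>exit_time n j x\<close>) belongs to the cylinder over the cube.\<close>

lemma exit_time_range:
  assumes "x \<in> cube n" "j < n"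
  shows "0 \<le> exit_time n j x" "exit_time n j x \<le> 1"
  using side_dist_nonneg[of n x j] side_dist_le_half[of j x n] cubeD[OF assms] cubeD[OF assms(1)]
  by (auto simp: exit_time_def min_def)

text \<open>A point of the horn makes one of the two terms of the minimum vanish. It is this that
  sends the horn into the bottom of the cylinder, where the lift is prescribed.\<close>

lemma exit_time_horn:
  assumes "x \<in> horn n j" "j < n"
  shows "exit_time n j x = 0"
proof -
  have x: "x \<in> cube n" using assms horn_subset_cube by blast
  have "min (side_dist j x n) (1 - x ! j) \<le> 0"
  proof (cases "x ! j = 1")
    case False
    then obtain i where "i < n" "i \<noteq> j" "x ! i = 0 \<or> x ! i = 1"
      using assms(1) by (auto simp: horn_def)
    then show ?thesis using side_dist_le[of i n j x] by (auto simp: min_le_iff_disj)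
  qed simp
  then show ?thesis using exit_time_range(1)[OF x assms(2)] by (auto simp: exit_time_def min_def split: if_splits)
qed

lemma push_out_mem_cube:
  assumes "x \<in> cube n" "0 \<le> s" "j < n"
  shows "push_out n j s x \<in> cube n"
  using assms cubeD[OF assms(1,3)] by (auto simp: mem_cube push_out_def)

lemma push_out_zero:
  assumes "x \<in> cube n"
  shows "push_out n j 0 x = x"
  using assms by (auto simp: push_out_def mem_cube intro!: nth_equalityI)

text \<open>Let d be the side distance. If coordinate j has not reached 1, the time is 2 d and 4 d <
  1, so d is attained by a coordinate i equal to d or 1 - d. Stretching carries it to 4 d d - d,
  which is at most 0, or to 1 + d - 4 d d, which is at least 1; clamping then gives exactly 0 or
  1.\<close>

lemma push_out_exit_time:
  assumes x: "x \<in> cube n" and j: "j < n"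
  shows "push_out n j (exit_time n j x) x \<in> horn n j"
proof -
  define d where "d = side_dist j x n"
  define u where "u = exit_time n j x"
  have u: "u = 2 * min d (1 - x ! j)" by (simp add: u_def d_def exit_time_def)
  have u0: "0 \<le> u" using exit_time_range[OF x j] by (simp add: u_def)
  have d0: "0 \<le> d" unfolding d_def using cubeD[OF x] by (intro side_dist_nonneg)
  let ?y = "push_out n j u x"
  have y: "?y \<in> cube n" by (rule push_out_mem_cube[OF x u0 j])
  have "?y ! j = 1 \<or> (\<exists>i<n. i \<noteq> j \<and> (?y ! i = 0 \<or> ?y ! i = 1))"
  proof (cases "1 \<le> x ! j + 2 * u")
    case True
    then show ?thesis using j by (simp add: push_out_def)
  next
    case False
    \<comment> \<open>Were the minimum 1 - x_j, then x_j + 2 u would equal 4 - 3 x_j, which is at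
      least 1.\<close>
    then have ud: "u = 2 * d" using cubeD[OF x j] by (auto simp: u min_def split: if_splits)
    then have d4: "4 * d < 1" using False cubeD[OF x j] by simp
    then obtain i where i: "i < n" "i \<noteq> j" "d = min (x ! i) (1 - x ! i)"
      using side_dist_attained[of j x n] unfolding d_def by auto
    have neg: "4 * (d * d) \<le> d"
      using mult_right_mono[of "4 * d" 1 d] d4 d0 by simp
    from i(3) consider "x ! i = d" | "x ! i = 1 - d" by (auto simp: min_def split: if_splits)
    then show ?thesis
    proof cases
      case 1
      have "1 / 2 + (1 + 2 * u) * (x ! i - 1 / 2) = 4 * (d * d) - d"
        by (simp add: 1 ud algebra_simps)
      then have "?y ! i = 0" using i(1,2) neg by (simp add: push_out_def)
      with i show ?thesis by blast
    next
      case 2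
      have "1 / 2 + (1 + 2 * u) * (x ! i - 1 / 2) = 1 + d - 4 * (d * d)"
        by (simp add: 2 ud field_simps)
      then have "?y ! i = 1" using i(1,2) neg by (simp add: push_out_def)
      with i show ?thesis by blast
    qed
  qed
  with y show ?thesis unfolding horn_def u_def by blast
qed

lemma dfun_side_dist:
  assumes "definable R m X" "n \<le> m"
  shows "dfun R m X (\<lambda>x. side_dist j x n)"
  using assms(2)
proof (induction n)
  case 0
  show ?case using dfun_const[OF assms(1)] by simp
next
  case (Suc n)
  then show ?case
    using assms(1)
    by (cases "n = j") (auto intro!: dfun_min dfun_diff dfun_nth dfun_const simp del: One_nat_def)
qed

lemma dfun_exit_time:
  assumes "definable R m X" "n \<le> m" "j < n"
  shows "dfun R m X (exit_time n j)"
  unfolding exit_time_def using assms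
  by (intro dfun_mult dfun_min dfun_diff dfun_side_dist dfun_nth dfun_const) auto

text \<open>The time s may vary with the point and the ambient dimension m may exceed n: the
  retraction of the cylinder needs both.\<close>

lemma dmap_push_out:
  assumes "definable R m X" "n \<le> m" "j < n" "dfun R m X s"
  shows "dmap R m X n (\<lambda>x. push_out n j (s x) x)"
proof (rule dmap_coords)
  fix i assume i: "i < n"
  show "dfun R m X (\<lambda>x. if i = j then min 1 (x ! j + 2 * s x)
     else max 0 (min 1 (1 / 2 + (1 + 2 * s x) * (x ! i - 1 / 2))))"
    using assms i
    by (cases "i = j")
      (auto intro!: dfun_min dfun_max dfun_add dfun_mult dfun_diff dfun_nth dfun_const
        simp del: One_nat_def)
qed (use assms in \<open>auto simp: push_out_def\<close>)

lemma take_snoc_cube: "z \<in> cube (n + 1) \<Longrightarrow> z = take n z @ [z ! n] \<and> take n z \<in> cube n \<and> 0 \<le> z ! n \<and> z ! n \<le> 1"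
  by (auto simp: mem_cube take_Suc_conv_app_nth[symmetric])

lemma Serre_lifting:
  assumes "definable_Serre_fibration R k E l B p" "definable R m X" "closed_bounded m X"
    "definable_map R (m + 1) (times_I X) l B H" "definable_map R m X k E f"
    "\<And>x. x \<in> X \<Longrightarrow> p (f x) = H (x @ [0])"
  obtains H' where "definable_map R (m + 1) (times_I X) k E H'"
    "\<And>z. z \<in> times_I X \<Longrightarrow> p (H' z) = H z" "\<And>x. x \<in> X \<Longrightarrow> H' (x @ [0]) = f x"
  using assms unfolding definable_Serre_fibration_def by metis

text \<open>
  The maps \<open>x \<mapsto> (x, exit_time x)\<close> and \<open>(x, s) \<mapsto> push_out (max 0 (exit_time x - s)) x\<close> exhibit the
  pair of a cube and a horn as a retract of the pair \<open>(cube \<times> I, cube \<times> 0)\<close>.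
\<close>

lemma horn_lifting:
  assumes p: "definable_Serre_fibration R k E l B p" and j: "j < n"
    and g: "definable_map R n (cube n) l B g"
    and f: "dmap R n (horn n j) k f" "f ` horn n j \<subseteq> E"
    and pf: "\<And>x. x \<in> horn n j \<Longrightarrow> p (f x) = g x"
  obtains G where "definable_map R n (cube n) k E G"
    "\<And>x. x \<in> cube n \<Longrightarrow> p (G x) = g x" "\<And>x. x \<in> horn n j \<Longrightarrow> G x = f x"
proof -
  let ?u = "exit_time n j"
  let ?r = "\<lambda>z. push_out n j (max 0 (?u z - z ! n)) z"
  let ?q = "\<lambda>x. push_out n j (?u x) x"
  have gd: "dmap R n (cube n) l g" "definable R l B" "g ` cube n \<subseteq> B"
    using g by (auto simp: definable_map_iff)
  have E: "definable R k E"
    using p by (simp add: definable_Serre_fibration_def definable_map_def)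
  have r: "dmap R (n + 1) (cube (n + 1)) n ?r"
    using j by (intro dmap_push_out dfun_max dfun_diff dfun_exit_time dfun_nth dfun_const definable_cube) auto
  have r_snoc: "?r (x @ [s]) = push_out n j (max 0 (?u x - s)) x" if "x \<in> cube n" for x s
    using cube_length[OF that] j by (simp add: exit_time_snoc push_out_snoc nth_append)
  have r_cube: "?r z \<in> cube n" if "z \<in> cube (n + 1)" for z
    using take_snoc_cube[OF that] r_snoc[of "take n z" "z ! n"] push_out_mem_cube[of "take n z" n _ j] j
    by (metis max.cobounded1)
  \<comment> \<open>The homotopy to be lifted is g after the retraction \<open>?r\<close>. At time 0
    the retraction lands in the horn, where f lifts g, so the starting map of the lift is f after
    \<open>?q\<close>.\<close>
  have H: "definable_map R (n + 1) (times_I (cube n)) l B (\<lambda>z. g (?r z))"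
    unfolding definable_map_iff times_I_cube
    using dmap_compose[OF r gd(1) r_cube] gd r_cube by blast
  have r0: "dmap R n (cube n) n ?q"
    using j by (intro dmap_push_out dfun_exit_time definable_cube) auto
  have h: "definable_map R n (cube n) k E (\<lambda>x. f (?q x))"
    unfolding definable_map_iff
    using dmap_compose[OF r0 f(1) push_out_exit_time[OF _ j]] E f(2) push_out_exit_time[OF _ j] by blast
  have "p (f (?q x)) = g (?r (x @ [0]))" if x: "x \<in> cube n" for x
    using pf[OF push_out_exit_time[OF x j]] r_snoc[OF x, of 0] exit_time_range[OF x j] by simp
  from Serre_lifting[OF p definable_cube closed_bounded_cube H h this]
  obtain H' where H': "definable_map R (n + 1) (times_I (cube n)) k E H'"
    "\<And>z. z \<in> times_I (cube n) \<Longrightarrow> p (H' z) = g (?r z)" "\<And>x. x \<in> cube n \<Longrightarrow> H' (x @ [0]) = f (?q x)"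
    by blast
  have H'd: "dmap R (n + 1) (cube (n + 1)) k H'" "H' ` cube (n + 1) \<subseteq> E"
    using H'(1) by (auto simp: definable_map_iff times_I_cube)
  have iu: "dmap R n (cube n) (n + 1) (\<lambda>x. x @ [?u x])"
  proof (rule dmap_append)
    show "dmap R n (cube n) n (\<lambda>x. x)"
      by (rule dmap_cong[OF dmap_take[OF definable_cube order.refl]]) (simp add: cube_length)
    show "dfun R n (cube n) ?u" using j by (intro dfun_exit_time definable_cube) auto
  qed
  have iu_mem: "x @ [?u x] \<in> cube (n + 1)" if "x \<in> cube n" for x
    using exit_time_range[OF that j] that by (simp add: snoc_mem_cube)
  \<comment> \<open>The lift is restricted to the graph of the exit time. There the remaining time
    is 0 and \<open>?r\<close> returns x, so a lift of g results; on the horn the graph lies at time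
    0, where the lift is f.\<close>
  show thesis
  proof
    show "definable_map R n (cube n) k E (\<lambda>x. H' (x @ [?u x]))"
      unfolding definable_map_iff using dmap_compose[OF iu H'd(1) iu_mem] E H'd(2) iu_mem by blast
    show "p (H' (x @ [?u x])) = g x" if "x \<in> cube n" for x
      using H'(2) iu_mem[OF that] r_snoc[OF that] push_out_zero[OF that] by (simp add: times_I_cube)
    show "H' (x @ [?u x]) = f x" if "x \<in> horn n j" for x
    proof -
      have "x \<in> cube n" using that horn_subset_cube by blast
      then show ?thesis using exit_time_horn[OF that j] H'(3) push_out_zero[of x n j] by simp
    qed
  qed
qed

subsection \<open>Homotopies of maps of pairs\<close>

lemma cube_J_subset_cube: "0 < n \<Longrightarrow> cube_J n \<subseteq> cube n"
  by (simp add: cube_J_eq horn_subset_cube)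

lemma cube_face_subset_cube: "cube_face n \<subseteq> cube n"
  by (auto simp: cube_face_def)

lemma rel_maps_iff:
  assumes "0 < n"
  shows "f \<in> rel_maps R n k X A x\<^sub>0 \<longleftrightarrow>
    definable_map R n (cube n) k X f \<and> (\<forall>t\<in>cube_face n. f t \<in> A) \<and> (\<forall>t\<in>cube_J n. f t = x\<^sub>0)"
  using cube_J_nonempty[OF assms, where 'a = 'a] by (auto simp: rel_maps_def)

text \<open>The face and \<open>cube_J n\<close> make up the boundary, so sending each of them to
  the base point is the absolute condition. Equality of the two sets of maps carries over to
  homotopies and classes.\<close>

lemma abs_maps_eq_rel_maps:
  assumes "0 < n"
  shows "abs_maps R n k X x\<^sub>0 = rel_maps R n k X {x\<^sub>0} x\<^sub>0"
proof (rule Set.set_eqI)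
  show "f \<in> abs_maps R n k X x\<^sub>0 \<longleftrightarrow> f \<in> rel_maps R n k X {x\<^sub>0} x\<^sub>0" for f
    using assms by (auto simp: rel_maps_iff abs_maps_def cube_boundary_eq_face_Un_J)
qed

lemma abs_pi_eq_rel_pi: "0 < n \<Longrightarrow> abs_pi R n k X x\<^sub>0 = rel_pi R n k X {x\<^sub>0} x\<^sub>0"
  by (simp add: abs_pi_def rel_pi_def abs_maps_eq_rel_maps)

text \<open>The conditions on all slices are stated for the points of the (n + 1)-cube. A homotopy
  is then a single map, which can be pasted, concatenated and lifted like any other.\<close>

definition pair_homotopy ::
  "('a::linordered_field, 'f, 'r) expansion \<Rightarrow> nat \<Rightarrow> nat \<Rightarrow> 'a list set \<Rightarrow> 'a list set \<Rightarrow>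
     'a list \<Rightarrow> ('a list \<Rightarrow> 'a list) \<Rightarrow> bool" where
  "pair_homotopy R n k X A x\<^sub>0 H \<longleftrightarrow>
     dmap R (n + 1) (cube (n + 1)) k H \<and> definable R k X \<and> (\<forall>z\<in>cube (n + 1). H z \<in> X) \<and>
     (\<forall>z\<in>cube (n + 1). take n z \<in> cube_face n \<longrightarrow> H z \<in> A) \<and>
     (\<forall>z\<in>cube (n + 1). take n z \<in> cube_J n \<longrightarrow> H z = x\<^sub>0)"

lemma pair_homotopyD:
  assumes "pair_homotopy R n k X A x\<^sub>0 H"
  shows "dmap R (n + 1) (cube (n + 1)) k H" "definable R k X"
    "\<And>z. z \<in> cube (n + 1) \<Longrightarrow> H z \<in> X"
    "\<And>z. z \<in> cube (n + 1) \<Longrightarrow> take n z \<in> cube_face n \<Longrightarrow> H z \<in> A"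
    "\<And>z. z \<in> cube (n + 1) \<Longrightarrow> take n z \<in> cube_J n \<Longrightarrow> H z = x\<^sub>0"
  using assms by (auto simp: pair_homotopy_def)

abbreviation htp ::
  "('a::linordered_field, 'f, 'r) expansion \<Rightarrow> nat \<Rightarrow> nat \<Rightarrow> 'a list set \<Rightarrow> 'a list set \<Rightarrow>
     'a list \<Rightarrow> ('a list \<Rightarrow> 'a list) rel" where
  "htp R n k X A x\<^sub>0 \<equiv> homotopy_rel R n k X (rel_maps R n k X A x\<^sub>0)"

lemma definable_map_cong:
  "definable_map R m X k Y f \<Longrightarrow> (\<And>x. x \<in> X \<Longrightarrow> f x = g x) \<Longrightarrow> definable_map R m X k Y g"
  unfolding definable_map_iff by (auto intro: dmap_cong)

lemma rel_maps_cong: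
  assumes n: "0 < n" and f: "f \<in> rel_maps R n k X A x\<^sub>0" and eq: "\<And>t. t \<in> cube n \<Longrightarrow> f t = g t"
  shows "g \<in> rel_maps R n k X A x\<^sub>0"
proof -
  have "f t = g t" if "t \<in> cube_face n \<or> t \<in> cube_J n" for t
    using that eq cube_J_subset_cube[OF n] cube_face_subset_cube by blast
  then show ?thesis
    using f definable_map_cong[of R n "cube n" k X f g, OF _ eq] by (auto simp: rel_maps_iff[OF n])
qed

text \<open>Membership of f and g in \<open>rel_maps\<close> is implicit on the right: on the cube
  they agree with the slices at times 0 and 1.\<close>

lemma homotopy_rel_iff:
  assumes n: "0 < n"
  shows "(f, g) \<in> htp R n k X A x\<^sub>0 \<longleftrightarrow>
    (\<exists>H. pair_homotopy R n k X A x\<^sub>0 H \<and> (\<forall>t\<in>cube n. H (t @ [0]) = f t) \<and> (\<forall>t\<in>cube n. H (t @ [1]) = g t))"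
    (is "?L \<longleftrightarrow> ?R")
proof
  assume ?L
  then obtain H where H: "definable_map R (n + 1) (times_I (cube n)) k X H"
    "\<forall>t\<in>cube n. H (t @ [0]) = f t" "\<forall>t\<in>cube n. H (t @ [1]) = g t"
    "\<And>s. s \<in> {0..1} \<Longrightarrow> (\<lambda>t. H (t @ [s])) \<in> rel_maps R n k X A x\<^sub>0"
    by (auto simp: homotopy_rel_def)
  have "pair_homotopy R n k X A x\<^sub>0 H"
    unfolding pair_homotopy_def
  proof (intro conjI ballI impI)
    show "dmap R (n + 1) (cube (n + 1)) k H" "definable R k X"
      using H(1) by (auto simp: definable_map_iff times_I_cube)
    fix z :: "'a list" assume z: "z \<in> cube (n + 1)"
    show "H z \<in> X" using H(1) z by (auto simp: definable_map_iff times_I_cube)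
    have zs: "z = take n z @ [z ! n]" "z ! n \<in> {0..1}" using take_snoc_cube[OF z] by auto
    show "H z \<in> A" if "take n z \<in> cube_face n"
      using H(4)[OF zs(2)] that zs(1) unfolding rel_maps_iff[OF n] by metis
    show "H z = x\<^sub>0" if "take n z \<in> cube_J n"
      using H(4)[OF zs(2)] that zs(1) unfolding rel_maps_iff[OF n] by metis
  qed
  with H show ?R by blast
next
  assume ?R
  then obtain H where H: "pair_homotopy R n k X A x\<^sub>0 H"
    and H0: "\<And>t. t \<in> cube n \<Longrightarrow> H (t @ [0]) = f t" and H1: "\<And>t. t \<in> cube n \<Longrightarrow> H (t @ [1]) = g t" by blast
  note Hd = pair_homotopyD[OF H]
  have slice: "(\<lambda>t. H (t @ [s])) \<in> rel_maps R n k X A x\<^sub>0" if s: "s \<in> {0..1}" for s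
    unfolding rel_maps_iff[OF n]
  proof (intro conjI ballI)
    have mem: "t @ [s] \<in> cube (n + 1)" if "t \<in> cube n" for t
      using that s by (simp add: snoc_mem_cube)
    have "dmap R n (cube n) (n + 1) (\<lambda>t. take n t @ [s])"
      by (intro dmap_append dmap_take dfun_const definable_cube) simp
    then have "dmap R n (cube n) (n + 1) (\<lambda>t. t @ [s])"
      by (rule dmap_cong) (simp add: cube_length)
    from dmap_compose[OF this Hd(1) mem]
    show "definable_map R n (cube n) k X (\<lambda>t. H (t @ [s]))"
      unfolding definable_map_iff using Hd(2,3) mem by blast
    show "H (t @ [s]) \<in> A" if t: "t \<in> cube_face n" for t
    proof -
      have "t \<in> cube n" using t cube_face_subset_cube by blast
      then show ?thesis using Hd(4)[OF mem] t by (simp add: cube_length)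
    qed
    show "H (t @ [s]) = x\<^sub>0" if t: "t \<in> cube_J n" for t
    proof -
      have "t \<in> cube n" using t cube_J_subset_cube[OF n] by blast
      then show ?thesis using Hd(5)[OF mem] t by (simp add: cube_length)
    qed
  qed
  have "f \<in> rel_maps R n k X A x\<^sub>0" by (rule rel_maps_cong[OF n slice[of 0] H0]) auto
  moreover have "g \<in> rel_maps R n k X A x\<^sub>0" by (rule rel_maps_cong[OF n slice[of 1] H1]) auto
  moreover have "definable_map R (n + 1) (times_I (cube n)) k X H"
    unfolding definable_map_iff times_I_cube using Hd(1-3) by blast
  ultimately show ?L using slice H0 H1 unfolding homotopy_rel_def by blast
qed

lemma pair_homotopy_const:
  assumes n: "0 < n" and f: "f \<in> rel_maps R n k X A x\<^sub>0"
  shows "pair_homotopy R n k X A x\<^sub>0 (\<lambda>z. f (take n z))"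
proof -
  have f': "dmap R n (cube n) k f" "definable R k X" "f ` cube n \<subseteq> X"
    using f unfolding rel_maps_iff[OF n] definable_map_iff by auto
  have "dmap R (n + 1) (cube (n + 1)) k (\<lambda>z. f (take n z))"
    using take_snoc_cube by (intro dmap_compose[OF dmap_take f'(1)] definable_cube) auto
  then show ?thesis
    using f f'(2,3) take_snoc_cube unfolding pair_homotopy_def rel_maps_iff[OF n] by blast
qed

text \<open>The constant homotopy of f also ends at g. This yields reflexivity and absorbs the
  arbitrary values of functions off the cube.\<close>

lemma homotopy_rel_if_eq_on_cube:
  assumes n: "0 < n" and f: "f \<in> rel_maps R n k X A x\<^sub>0" and eq: "\<And>t. t \<in> cube n \<Longrightarrow> f t = g t"
  shows "(f, g) \<in> htp R n k X A x\<^sub>0"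
  unfolding homotopy_rel_iff[OF n]
  by (intro exI[of _ "\<lambda>z. f (take n z)"] conjI pair_homotopy_const[OF n f]) (auto simp: cube_length eq)

lemma homotopy_rel_sym:
  assumes n: "0 < n" and fg: "(f, g) \<in> htp R n k X A x\<^sub>0"
  shows "(g, f) \<in> htp R n k X A x\<^sub>0"
proof -
  obtain H where H: "pair_homotopy R n k X A x\<^sub>0 H"
    and H0: "\<And>t. t \<in> cube n \<Longrightarrow> H (t @ [0]) = f t" and H1: "\<And>t. t \<in> cube n \<Longrightarrow> H (t @ [1]) = g t"
    using fg unfolding homotopy_rel_iff[OF n] by blast
  note Hd = pair_homotopyD[OF H]
  let ?q = "\<lambda>z. take n z @ [1 - z ! n]"
  have q: "?q z \<in> cube (n + 1)" "take n (?q z) = take n z" if "z \<in> cube (n + 1)" for z :: "'a list"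
    using take_snoc_cube[OF that] cube_length[OF that] by (auto simp: snoc_mem_cube)
  have "dmap R (n + 1) (cube (n + 1)) (n + 1) ?q"
    by (intro dmap_append dmap_take dfun_diff dfun_const dfun_nth definable_cube) auto
  from dmap_compose[OF this Hd(1) q(1)]
  have "pair_homotopy R n k X A x\<^sub>0 (\<lambda>z. H (?q z))"
    unfolding pair_homotopy_def using Hd(2-5) q by auto
  then show ?thesis
    unfolding homotopy_rel_iff[OF n] using H0 H1
    by (intro exI[of _ "\<lambda>z. H (?q z)"]) (auto simp: cube_length nth_append)
qed

lemma homotopy_rel_trans:
  assumes n: "0 < n" and fg: "(f, g) \<in> htp R n k X A x\<^sub>0" and gh: "(g, h) \<in> htp R n k X A x\<^sub>0"
  shows "(f, h) \<in> htp R n k X A x\<^sub>0"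
proof -
  obtain H where H: "pair_homotopy R n k X A x\<^sub>0 H"
    and H0: "\<And>t. t \<in> cube n \<Longrightarrow> H (t @ [0]) = f t" and H1: "\<And>t. t \<in> cube n \<Longrightarrow> H (t @ [1]) = g t"
    using fg unfolding homotopy_rel_iff[OF n] by blast
  obtain K where K: "pair_homotopy R n k X A x\<^sub>0 K"
    and K0: "\<And>t. t \<in> cube n \<Longrightarrow> K (t @ [0]) = g t" and K1: "\<And>t. t \<in> cube n \<Longrightarrow> K (t @ [1]) = h t"
    using gh unfolding homotopy_rel_iff[OF n] by blast
  note Hd = pair_homotopyD[OF H] and Kd = pair_homotopyD[OF K]
  let ?C = "cube (n + 1) :: 'a list set"
  define A1 where "A1 = {z \<in> ?C. 2 * z ! n \<le> 1}"
  define A2 where "A2 = {z \<in> ?C. 1 \<le> 2 * z ! n}"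
  define q where "q z = take n z @ [2 * z ! n]" for z :: "'a list"
  define r where "r z = take n z @ [2 * z ! n - 1]" for z :: "'a list"
  have q: "q z \<in> ?C" "take n (q z) = take n z" if "z \<in> A1" for z
    using take_snoc_cube[of z n] that by (auto simp: snoc_mem_cube cube_length q_def A1_def)
  have r: "r z \<in> ?C" "take n (r z) = take n z" if "z \<in> A2" for z
    using take_snoc_cube[of z n] that by (auto simp: snoc_mem_cube cube_length r_def A2_def)
  have two: "dfun R (n + 1) ?C (\<lambda>z. 2 * z ! n)"
    by (intro dfun_mult dfun_const dfun_nth definable_cube) auto
  have one: "dfun R (n + 1) ?C (\<lambda>z. 1)" by (intro dfun_const definable_cube)
  have A: "definable R (n + 1) A1" "definable R (n + 1) A2"
    "closed_within (n + 1) ?C A1" "closed_within (n + 1) ?C A2"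
    unfolding A1_def A2_def using two one
    by (auto intro: definable_le closed_within_le simp del: One_nat_def)
  have dq: "dmap R (n + 1) A1 (n + 1) q" "dmap R (n + 1) A2 (n + 1) r"
    unfolding q_def r_def
    by (intro dmap_append dmap_take dfun_mult dfun_diff dfun_const dfun_nth A; simp)+
  let ?L = "\<lambda>z. if z \<in> A1 then H (q z) else K (r z)"
  have un: "?C = A1 \<union> A2" by (auto simp: A1_def A2_def)
  have agree: "H (q z) = K (r z)" if "z \<in> A1" "z \<in> A2" for z
  proof -
    have "2 * z ! n = 1" "take n z \<in> cube n" using that take_snoc_cube[of z n] by (auto simp: A1_def A2_def)
    then show ?thesis using H1 K0 by (simp add: q_def r_def)
  qed
  note L = dmap_paste[OF dmap_compose[OF dq(1) Hd(1) q(1)] dmap_compose[OF dq(2) Kd(1) r(1)]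
      un A(3,4) agree]
  have "?L z \<in> X \<and> (take n z \<in> cube_face n \<longrightarrow> ?L z \<in> A) \<and> (take n z \<in> cube_J n \<longrightarrow> ?L z = x\<^sub>0)"
    if "z \<in> ?C" for z
  proof (cases "z \<in> A1")
    case True
    then show ?thesis using Hd(3-5)[OF q(1)[OF True]] q(2)[OF True] by simp
  next
    case False
    then have "z \<in> A2" using that un by blast
    then show ?thesis using Kd(3-5)[OF r(1)] r(2) False by simp
  qed
  then have "pair_homotopy R n k X A x\<^sub>0 ?L"
    unfolding pair_homotopy_def using L Hd(2) by blast
  moreover have "?L (t @ [0]) = f t" "?L (t @ [1]) = h t" if t: "t \<in> cube n" for t
    using that H0[OF t] K1[OF t]
    by (auto simp: A1_def q_def r_def snoc_mem_cube nth_append cube_length)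
  ultimately show ?thesis unfolding homotopy_rel_iff[OF n] by blast
qed

lemma equiv_homotopy_rel:
  assumes n: "0 < n"
  shows "equiv (rel_maps R n k X A x\<^sub>0) (htp R n k X A x\<^sub>0)"
proof (rule equivI)
  show "htp R n k X A x\<^sub>0 \<subseteq> rel_maps R n k X A x\<^sub>0 \<times> rel_maps R n k X A x\<^sub>0"
    by (auto simp: homotopy_rel_def)
  show "refl_on (rel_maps R n k X A x\<^sub>0) (htp R n k X A x\<^sub>0)"
    by (rule refl_onI) (rule homotopy_rel_if_eq_on_cube[OF n], auto)
  show "sym (htp R n k X A x\<^sub>0)" by (rule symI) (rule homotopy_rel_sym[OF n])
  show "trans (htp R n k X A x\<^sub>0)" by (rule transI) (rule homotopy_rel_trans[OF n])
qed

subsection \<open>Concatenation\<close>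

lemma cube_cases:
  assumes "t \<in> cube n" "0 < n"
  obtains a y where "t = a # y" "y \<in> cube (n - 1)" "0 \<le> a" "a \<le> 1"
  using assms by (cases t) (auto simp: cube_def)

lemma Cons_mem_cube: "a # y \<in> cube n \<longleftrightarrow> 0 < n \<and> y \<in> cube (n - 1) \<and> 0 \<le> a \<and> a \<le> 1"
  by (cases n) (auto simp: cube_def)

text \<open>Only the matching of the two middle faces is assumed, not the conditions on maps of
  pairs, because the lemma is applied to homotopies in dimension n + 1.\<close>

lemma dmap_concat_maps:
  assumes n: "0 < n" and f: "dmap R n (cube n) k f" and g: "dmap R n (cube n) k g"
    and eq: "\<And>y. y \<in> cube (n - 1) \<Longrightarrow> f (1 # y) = g (0 # y)"
  shows "dmap R n (cube n) k (concat_maps f g)"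
proof -
  let ?C = "cube n :: 'a list set"
  define A1 where "A1 = {t \<in> ?C. 2 * t ! 0 \<le> 1}"
  define A2 where "A2 = {t \<in> ?C. 1 \<le> 2 * t ! 0}"
  define q where "q t = (2 * t ! 0) # tl t" for t :: "'a list"
  define r where "r t = (2 * t ! 0 - 1) # tl t" for t :: "'a list"
  have q: "q t \<in> ?C" if t: "t \<in> A1" for t
  proof -
    obtain a y where "t = a # y" "y \<in> cube (n - 1)" "0 \<le> a" "a \<le> 1"
      using t n cube_cases[of t n] by (auto simp: A1_def)
    then show ?thesis using t n by (simp add: A1_def q_def Cons_mem_cube)
  qed
  have r: "r t \<in> ?C" if t: "t \<in> A2" for t
  proof -
    obtain a y where "t = a # y" "y \<in> cube (n - 1)" "0 \<le> a" "a \<le> 1"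
      using t n cube_cases[of t n] by (auto simp: A2_def)
    then show ?thesis using t n by (simp add: A2_def r_def Cons_mem_cube)
  qed
  have two: "dfun R n ?C (\<lambda>t. 2 * t ! 0)"
    using n by (intro dfun_mult dfun_const dfun_nth definable_cube) auto
  have one: "dfun R n ?C (\<lambda>t. 1)" by (intro dfun_const definable_cube)
  have A: "definable R n A1" "definable R n A2" "closed_within n ?C A1" "closed_within n ?C A2"
    unfolding A1_def A2_def using two one
    by (auto intro: definable_le closed_within_le simp del: One_nat_def)
  have dq: "dmap R n A1 n q"
  proof (rule dmap_coords)
    show "dfun R n A1 (\<lambda>t. if i = 0 then 2 * t ! 0 else t ! i)" if "i < n" for i
      using that A(1) n by (cases "i = 0") (auto intro!: dfun_mult dfun_const dfun_nth simp del: One_nat_def)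
  qed (use n A in \<open>auto simp: A1_def q_def nth_Cons' nth_tl cube_length\<close>)
  have dr: "dmap R n A2 n r"
  proof (rule dmap_coords)
    show "dfun R n A2 (\<lambda>t. if i = 0 then 2 * t ! 0 - 1 else t ! i)" if "i < n" for i
      using that A(2) n
      by (cases "i = 0") (auto intro!: dfun_diff dfun_mult dfun_const dfun_nth simp del: One_nat_def)
  qed (use n A in \<open>auto simp: A2_def r_def nth_Cons' nth_tl cube_length\<close>)
  have un: "?C = A1 \<union> A2" by (auto simp: A1_def A2_def)
  have agree: "f (q t) = g (r t)" if "t \<in> A1" "t \<in> A2" for t
  proof -
    have "t \<in> ?C" "2 * t ! 0 = 1" using that by (auto simp: A1_def A2_def)
    moreover obtain a y where "t = a # y" "y \<in> cube (n - 1)" using cube_cases[of t n] calculation(1) n by metis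
    ultimately show ?thesis using eq by (simp add: q_def r_def)
  qed
  show ?thesis
  proof (rule dmap_cong[OF dmap_paste[OF dmap_compose[OF dq f q] dmap_compose[OF dr g r] un A(3,4) agree]])
    fix t assume t: "t \<in> ?C"
    then obtain a y where "t = a # y" using cube_cases[of t n] n by metis
    with t show "(if t \<in> A1 then f (q t) else g (r t)) = concat_maps f g t"
      by (simp add: A1_def q_def r_def concat_maps_def)
  qed
qed

text \<open>In either half only the first coordinate changes, and its end values 0 and 1 are kept.
  The conditions on faces depend on nothing more, so the halves need no separate treatment
  later.\<close>

lemma concat_maps_cases:
  assumes "t \<in> cube n" "0 < n"
  obtains c where "0 \<le> c" "c \<le> 1" "hd t = 0 \<longrightarrow> c = 0" "hd t = 1 \<longrightarrow> c = 1"
    "concat_maps f g t = f (c # tl t) \<or> concat_maps f g t = g (c # tl t)"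
proof -
  obtain a y where t: "t = a # y" "0 \<le> a" "a \<le> 1" using cube_cases[OF assms] by metis
  show thesis
  proof (cases "2 * a \<le> 1")
    case True
    show thesis by (rule that[of "2 * a"]) (use True t in \<open>auto simp: concat_maps_def\<close>)
  next
    case False
    show thesis by (rule that[of "2 * a - 1"]) (use False t in \<open>auto simp: concat_maps_def\<close>)
  qed
qed

lemma rescale_mem_cube:
  assumes "t \<in> cube n" "0 < n" "0 \<le> c" "c \<le> 1"
  shows "c # tl t \<in> cube n"
  using assms(1,2) by (rule cube_cases) (use assms in \<open>auto simp: Cons_mem_cube\<close>)

text \<open>For n at least 2 the first coordinate differs from the last, which alone decides
  membership in the face.\<close>

lemma rescale_mem_face:
  assumes "t \<in> cube_face n" "2 \<le> n" "0 \<le> c" "c \<le> 1"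
  shows "c # tl t \<in> cube_face n"
proof -
  have t: "t \<in> cube n" "t ! (n - 1) = 0" using assms by (auto simp: cube_face_eq)
  have "(c # tl t) ! (n - 1) = t ! (n - 1)"
    using assms(2) cube_length[OF t(1)] by (cases t) (auto simp: nth_Cons')
  then show ?thesis
    using t rescale_mem_cube[OF t(1) _ assms(3,4)] assms(2) by (simp add: cube_face_eq)
qed

text \<open>If the extreme coordinate that places t in \<open>cube_J n\<close> is the first one, the
  conditions on c keep it extreme; any other one is untouched.\<close>

lemma rescale_mem_J:
  assumes t: "t \<in> cube_J n" and n: "2 \<le> n" and c: "0 \<le> c" "c \<le> 1" "hd t = 0 \<longrightarrow> c = 0" "hd t = 1 \<longrightarrow> c = 1"
  shows "c # tl t \<in> cube_J n"
proof -
  have n0: "0 < n" using n by simp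
  have tc: "t \<in> cube n" using t cube_J_subset_cube[OF n0] by blast
  have nz: "t \<noteq> []" using cube_length[OF tc] n0 by auto
  have eq: "(c # tl t) ! i = t ! i" if "0 < i" "i < n" for i
    using that cube_length[OF tc] by (cases t) (auto simp: nth_Cons')
  have "(c # tl t) ! (n - 1) = 1 \<or> (\<exists>i<n. i \<noteq> n - 1 \<and> ((c # tl t) ! i = 0 \<or> (c # tl t) ! i = 1))"
  proof -
    from t consider "t ! (n - 1) = 1" | i where "i < n" "i \<noteq> n - 1" "t ! i = 0 \<or> t ! i = 1"
      unfolding cube_J_eq[OF n0] horn_def by blast
    then show ?thesis
    proof cases
      case 1
      then show ?thesis using eq[of "n - 1"] n by simp
    next
      case 2
      show ?thesis
      proof (cases "i = 0")
        case True
        then show ?thesis using 2 c(3,4) nz by (auto simp: hd_conv_nth intro!: exI[of _ 0])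
      next
        case False
        then show ?thesis using 2 eq[of i] by auto
      qed
    qed
  qed
  then show ?thesis
    unfolding cube_J_eq[OF n0] horn_def using rescale_mem_cube[OF tc n0 c(1,2)] by blast
qed

text \<open>Time is the last coordinate and concatenation acts on the first, so the homotopies are
  concatenated as maps on the (n + 1)-cube. They match in the middle because a first coordinate 0 or
  1 puts the space point into \<open>cube_J n\<close>, where both are
  \<open>x\<^sub>0\<close>.\<close>

lemma pair_homotopy_concat_maps:
  assumes n: "2 \<le> n" and H: "pair_homotopy R n k X A x\<^sub>0 H" and K: "pair_homotopy R n k X A x\<^sub>0 K"
  shows "pair_homotopy R n k X A x\<^sub>0 (concat_maps H K)"
proof -
  note Hd = pair_homotopyD[OF H] and Kd = pair_homotopyD[OF K]
  have n0: "0 < n" using n by simp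
  have "H (1 # y) = K (0 # y)" if y: "y \<in> cube (n + 1 - 1)" for y
  proof -
    have mem: "c # y \<in> cube (n + 1)" if "0 \<le> c" "c \<le> 1" for c
      using that y by (simp add: Cons_mem_cube)
    have "take n (c # y) \<in> cube_J n" if "c = 0 \<or> c = 1" for c
      unfolding cube_J_eq[OF n0] horn_def
      using take_snoc_cube[OF mem[of c]] that n by (auto intro!: exI[of _ 0])
    then show ?thesis using Hd(5)[OF mem[of 1]] Kd(5)[OF mem[of 0]] by simp
  qed
  then have "dmap R (n + 1) (cube (n + 1)) k (concat_maps H K)"
    by (intro dmap_concat_maps Hd Kd) auto
  moreover have "concat_maps H K z \<in> X \<and> (take n z \<in> cube_face n \<longrightarrow> concat_maps H K z \<in> A) \<and>
      (take n z \<in> cube_J n \<longrightarrow> concat_maps H K z = x\<^sub>0)" if z: "z \<in> cube (n + 1)" for z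
  proof -
    obtain c where c: "0 \<le> c" "c \<le> 1" "hd z = 0 \<longrightarrow> c = 0" "hd z = 1 \<longrightarrow> c = 1"
      "concat_maps H K z = H (c # tl z) \<or> concat_maps H K z = K (c # tl z)"
      using concat_maps_cases[OF z, of H K] by auto
    have mem: "c # tl z \<in> cube (n + 1)" using rescale_mem_cube[OF z _ c(1,2)] by simp
    have hd: "hd (take n z) = hd z" using n0 by simp
    have take: "take n (c # tl z) = c # tl (take n z)"
      using n0 cube_length[OF z] by (cases n; cases z) auto
    show ?thesis
      using c(5) Hd(3-5)[OF mem] Kd(3-5)[OF mem] rescale_mem_face[of "take n z" n c]
        rescale_mem_J[of "take n z" n c] c(1-4) n unfolding take hd by metis
  qed
  ultimately show ?thesis unfolding pair_homotopy_def using Hd(2) by blast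
qed

lemma homotopy_rel_concat_maps:
  assumes n: "2 \<le> n" and f: "(f, f') \<in> htp R n k X A x\<^sub>0" and g: "(g, g') \<in> htp R n k X A x\<^sub>0"
  shows "(concat_maps f g, concat_maps f' g') \<in> htp R n k X A x\<^sub>0"
proof -
  have n0: "0 < n" using n by simp
  obtain H where H: "pair_homotopy R n k X A x\<^sub>0 H"
    and H0: "\<And>t. t \<in> cube n \<Longrightarrow> H (t @ [0]) = f t" and H1: "\<And>t. t \<in> cube n \<Longrightarrow> H (t @ [1]) = f' t"
    using f unfolding homotopy_rel_iff[OF n0] by blast
  obtain K where K: "pair_homotopy R n k X A x\<^sub>0 K"
    and K0: "\<And>t. t \<in> cube n \<Longrightarrow> K (t @ [0]) = g t" and K1: "\<And>t. t \<in> cube n \<Longrightarrow> K (t @ [1]) = g' t"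
    using g unfolding homotopy_rel_iff[OF n0] by blast
  \<comment> \<open>Concatenation commutes with taking the slice at time s. The slices are known
    only on the cube, so the rescaled points have to be shown to lie there.\<close>
  have "concat_maps H K (t @ [s]) = concat_maps F G t"
    if t: "t \<in> cube n" and F: "\<And>t. t \<in> cube n \<Longrightarrow> H (t @ [s]) = F t"
      and G: "\<And>t. t \<in> cube n \<Longrightarrow> K (t @ [s]) = G t" for t s F G
    using cube_cases[OF t n0]
  proof cases
    case (1 a y)
    have "2 * a # y \<in> cube n" if "2 * a \<le> 1" using 1 that n0 by (simp add: Cons_mem_cube)
    moreover have "(2 * a - 1) # y \<in> cube n" if "\<not> 2 * a \<le> 1" using 1 that n0 by (simp add: Cons_mem_cube)
    ultimately show ?thesis using F[of "2 * a # y"] G[of "(2 * a - 1) # y"] 1(1)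
      by (simp add: concat_maps_def)
  qed
  then have "concat_maps H K (t @ [0]) = concat_maps f g t" "concat_maps H K (t @ [1]) = concat_maps f' g' t"
    if "t \<in> cube n" for t
    using that H0 H1 K0 K1 by blast+
  then show ?thesis
    unfolding homotopy_rel_iff[OF n0] using pair_homotopy_concat_maps[OF n H K] by blast
qed

subsection \<open>The map induced by a fibration\<close>

lemma rel_pi_carrier: "carrier (rel_pi R n k X A x\<^sub>0) = rel_maps R n k X A x\<^sub>0 // htp R n k X A x\<^sub>0"
  by (simp add: rel_pi_def class_group_def)

text \<open>Concatenating constant homotopies gives a homotopy whose end is the concatenation, so
  membership needs no second check of the face conditions.\<close>

lemma concat_maps_mem_rel_maps:
  assumes n: "2 \<le> n" and f: "f \<in> rel_maps R n k X A x\<^sub>0" and g: "g \<in> rel_maps R n k X A x\<^sub>0"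
  shows "concat_maps f g \<in> rel_maps R n k X A x\<^sub>0"
proof -
  have "0 < n" using n by simp
  then have "(f, f) \<in> htp R n k X A x\<^sub>0" "(g, g) \<in> htp R n k X A x\<^sub>0"
    using f g homotopy_rel_if_eq_on_cube by blast+
  from homotopy_rel_concat_maps[OF n this] show ?thesis by (simp add: homotopy_rel_def)
qed

text \<open>The product is a union over all pairs of representatives; compatibility with homotopy
  makes all its terms equal.\<close>

lemma rel_pi_mult:
  assumes n: "2 \<le> n" and f: "f \<in> rel_maps R n k X A x\<^sub>0" and g: "g \<in> rel_maps R n k X A x\<^sub>0"
  shows "htp R n k X A x\<^sub>0 `` {f} \<otimes>\<^bsub>rel_pi R n k X A x\<^sub>0\<^esub> htp R n k X A x\<^sub>0 `` {g} =
    htp R n k X A x\<^sub>0 `` {concat_maps f g}"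
proof -
  have eq: "equiv (rel_maps R n k X A x\<^sub>0) (htp R n k X A x\<^sub>0)"
    using n by (intro equiv_homotopy_rel) simp
  have "congruent2 (htp R n k X A x\<^sub>0) (htp R n k X A x\<^sub>0)
      (\<lambda>f g. htp R n k X A x\<^sub>0 `` {concat_maps f g})"
    unfolding congruent2_def
    using homotopy_rel_concat_maps[OF n] equiv_class_eq[OF eq] by blast
  from UN_equiv_class2[OF eq eq this f g] show ?thesis
    by (simp add: rel_pi_def class_group_def)
qed

section \<open>Lifting homotopies and maps to the total space\<close>

lemma take_mem_cube_J:
  assumes n: "0 < n" and z: "z \<in> cube (n + 1)"
  shows "take n z \<in> cube_J n \<longleftrightarrow> z ! (n - 1) = 1 \<or> (\<exists>i<n. i \<noteq> n - 1 \<and> (z ! i = 0 \<or> z ! i = 1))"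
  unfolding cube_J_eq[OF n] horn_def
  using take_snoc_cube[OF z] n by (simp cong: conj_cong)

text \<open>Time is coordinate n, and the face of the pair is where coordinate n - 1 vanishes. A
  horn in dimension n + 1 with free direction n - 1 thus consists of both ends of the homotopy
  together with \<open>cube_J n\<close> times I, and what it leaves free lies over the face.\<close>

lemma lift_homotopy:
  assumes n: "0 < n" and p: "definable_Serre_fibration R k E l B p" and e0: "p e\<^sub>0 = b\<^sub>0"
    and f: "f \<in> rel_maps R n k E {e \<in> E. p e = b\<^sub>0} e\<^sub>0" and g: "g \<in> rel_maps R n k E {e \<in> E. p e = b\<^sub>0} e\<^sub>0"
    and pfg: "(p \<circ> f, p \<circ> g) \<in> htp R n l B {b\<^sub>0} b\<^sub>0"
  shows "(f, g) \<in> htp R n k E {e \<in> E. p e = b\<^sub>0} e\<^sub>0"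
proof -
  obtain H where H: "pair_homotopy R n l B {b\<^sub>0} b\<^sub>0 H"
    and H0: "\<And>t. t \<in> cube n \<Longrightarrow> H (t @ [0]) = p (f t)" and H1: "\<And>t. t \<in> cube n \<Longrightarrow> H (t @ [1]) = p (g t)"
    using pfg unfolding homotopy_rel_iff[OF n] by auto
  note Hd = pair_homotopyD[OF H]
  have fd: "dmap R n (cube n) k f" "\<And>t. t \<in> cube n \<Longrightarrow> f t \<in> E" "\<And>t. t \<in> cube_J n \<Longrightarrow> f t = e\<^sub>0"
    and gd: "dmap R n (cube n) k g" "\<And>t. t \<in> cube n \<Longrightarrow> g t \<in> E" "\<And>t. t \<in> cube_J n \<Longrightarrow> g t = e\<^sub>0"
    using f g unfolding rel_maps_iff[OF n] definable_map_iff by auto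
  \<comment> \<open>That \<open>e\<^sub>0\<close> lies in E and has length k is read off from the
    value of f at a corner of \<open>cube_J n\<close>.\<close>
  have Jne: "replicate n 1 \<in> (cube_J n :: 'a list set)" by (rule cube_J_nonempty[OF n])
  have e0E: "e\<^sub>0 \<in> E" and e0k: "length e\<^sub>0 = k"
    using fd(2,3) dmap_length[OF fd(1)] Jne cube_J_subset_cube[OF n] by (metis subsetD)+
  let ?j = "n - 1"
  let ?W = "horn (n + 1) ?j :: 'a list set"
  define W0 where "W0 = {z \<in> ?W. z ! n = 0}"
  define W1 where "W1 = {z \<in> ?W. z ! n = 1}"
  define WJ where "WJ = {z \<in> ?W. take n z \<in> cube_J n}"
  have Wc: "z \<in> cube (n + 1)" if "z \<in> ?W" for z using that horn_subset_cube by blast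
  have WJ_eq: "WJ = {z \<in> ?W. z ! ?j = 1 \<or> (\<exists>i<n. i \<noteq> ?j \<and> i < n + 1 \<and> (z ! i = 0 \<or> z ! i = 1))}"
  proof (rule Set.set_eqI)
    show "z \<in> WJ \<longleftrightarrow> z \<in> {z \<in> ?W. z ! ?j = 1 \<or> (\<exists>i<n. i \<noteq> ?j \<and> i < n + 1 \<and> (z ! i = 0 \<or> z ! i = 1))}" for z
      using take_mem_cube_J[OF n Wc, of z] by (simp add: WJ_def cong: conj_cong)
  qed
  have Wd: "definable R (n + 1) ?W" by (rule definable_horn) simp
  have dn: "dfun R (n + 1) ?W (\<lambda>z. z ! n)" "dfun R (n + 1) ?W (\<lambda>z. c)" for c
    by (intro dfun_nth dfun_const Wd; simp)+
  have D: "definable R (n + 1) W0" "definable R (n + 1) W1" "definable R (n + 1) WJ"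
    unfolding W0_def W1_def WJ_eq
    by (rule definable_eq[OF dn] definable_horn_cond[OF Wd] | simp)+
  have C: "closed_within (n + 1) ?W W0" "closed_within (n + 1) ?W W1" "closed_within (n + 1) ?W WJ"
    unfolding W0_def W1_def WJ_eq
    by (rule closed_within_eq[OF dn] closed_within_horn_cond[OF Wd] | simp)+
  have sub: "W0 \<subseteq> ?W" "W1 \<subseteq> ?W" "WJ \<subseteq> ?W" by (auto simp: W0_def W1_def WJ_def)
  \<comment> \<open>An extreme coordinate of index n lies at one end of the homotopy; one of smaller
    index already puts the first n coordinates into \<open>cube_J n\<close>.\<close>
  have un: "?W = W0 \<union> (W1 \<union> WJ)"
  proof
    show "?W \<subseteq> W0 \<union> (W1 \<union> WJ)"
    proof
      fix z assume z: "z \<in> ?W"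
      then consider "z ! ?j = 1" | i where "i < n + 1" "i \<noteq> ?j" "z ! i = 0 \<or> z ! i = 1"
        unfolding horn_def by blast
      then show "z \<in> W0 \<union> (W1 \<union> WJ)"
      proof cases
        case 1
        then show ?thesis using z by (simp add: WJ_eq)
      next
        case 2
        show ?thesis
        proof (cases "i = n")
          case True
          then show ?thesis using 2 z by (auto simp: W0_def W1_def)
        next
          case False
          then have "i < n" using 2 by simp
          then show ?thesis using 2 z unfolding WJ_eq by auto
        qed
      qed
    qed
  qed (use sub in blast)
  have tk: "take n z \<in> cube n" if "z \<in> ?W" for z using take_snoc_cube[OF Wc[OF that]] by simp
  have df: "dmap R (n + 1) W0 k (\<lambda>z. f (take n z))"
    using tk sub by (intro dmap_compose[OF dmap_take[OF D(1)] fd(1)]) auto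
  have dg: "dmap R (n + 1) W1 k (\<lambda>z. g (take n z))"
    using tk sub by (intro dmap_compose[OF dmap_take[OF D(2)] gd(1)]) auto
  have de: "dmap R (n + 1) WJ k (\<lambda>_. e\<^sub>0)"
    using dmap_const[OF D(3), of e\<^sub>0] e0k by simp
  \<comment> \<open>Three pieces need two pastings. The ends are disjoint, and where an end meets
    \<open>WJ\<close> both f and g have the value \<open>e\<^sub>0\<close>.\<close>
  define \<phi> where "\<phi> z = (if z \<in> W1 then g (take n z) else e\<^sub>0)" for z
  have C': "closed_within (n + 1) (W1 \<union> WJ) W1" "closed_within (n + 1) (W1 \<union> WJ) WJ"
    using closed_within_subset[OF C(2), of "W1 \<union> WJ"] closed_within_subset[OF C(3), of "W1 \<union> WJ"] sub
    by (simp_all add: Int_absorb1 Int_absorb2 Int_commute)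
  have d\<phi>: "dmap R (n + 1) (W1 \<union> WJ) k \<phi>"
    unfolding \<phi>_def by (rule dmap_paste[OF dg de refl C']) (simp add: WJ_def gd(3))
  define \<psi> where "\<psi> z = (if z \<in> W0 then f (take n z) else \<phi> z)" for z
  have d\<psi>: "dmap R (n + 1) ?W k \<psi>"
    unfolding \<psi>_def
    by (rule dmap_paste[OF df d\<phi> un C(1) closed_within_Un[OF C(2,3)]])
      (auto simp: W0_def W1_def WJ_def \<phi>_def fd(3))
  have \<psi>: "\<psi> z = f (take n z)" if "z \<in> W0" for z using that by (simp add: \<psi>_def)
  have \<psi>1: "\<psi> z = g (take n z)" if "z \<in> W1" for z
    using that by (auto simp: \<psi>_def \<phi>_def W0_def W1_def)
  have \<psi>J: "\<psi> z = e\<^sub>0" if "z \<in> WJ" for z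
    using that by (auto simp: \<psi>_def \<phi>_def WJ_def fd(3) gd(3))
  have \<psi>E: "\<psi> ` ?W \<subseteq> E"
  proof (rule image_subsetI)
    show "\<psi> z \<in> E" if z: "z \<in> ?W" for z
      using z un \<psi>[of z] \<psi>1[of z] \<psi>J[of z] fd(2)[OF tk[OF z]] gd(2)[OF tk[OF z]] e0E by auto
  qed
  have lift: "p (\<psi> z) = H z" if z: "z \<in> ?W" for z
  proof -
    have zs: "z = take n z @ [z ! n]" using take_snoc_cube[OF Wc[OF z]] by simp
    from z un consider "z \<in> W0" | "z \<in> W1" | "z \<in> WJ" by blast
    then show ?thesis
    proof cases
      case 1
      then have "z = take n z @ [0]" using zs by (simp add: W0_def)
      then show ?thesis using H0[OF tk[OF z]] \<psi>[OF 1] by simp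
    next
      case 2
      then have "z = take n z @ [1]" using zs by (simp add: W1_def)
      then show ?thesis using H1[OF tk[OF z]] \<psi>1[OF 2] by simp
    next
      case 3
      then show ?thesis using Hd(5)[OF Wc[OF z]] \<psi>J[OF 3] e0 by (simp add: WJ_def)
    qed
  qed
  have Hm: "definable_map R (n + 1) (cube (n + 1)) l B H"
    unfolding definable_map_iff using Hd(1-3) by blast
  have j: "?j < n + 1" by simp
  obtain G where G: "definable_map R (n + 1) (cube (n + 1)) k E G"
    "\<And>z. z \<in> cube (n + 1) \<Longrightarrow> p (G z) = H z" "\<And>z. z \<in> ?W \<Longrightarrow> G z = \<psi> z"
    using horn_lifting[OF p j Hm d\<psi> \<psi>E lift] by blast
  have GE: "G z \<in> E" if "z \<in> cube (n + 1)" for z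
    using G(1) that by (auto simp: definable_map_iff)
  have mem_WJ: "z \<in> WJ" if z: "z \<in> cube (n + 1)" "take n z \<in> cube_J n" for z
  proof -
    have "z \<in> ?W"
      using z take_mem_cube_J[OF n z(1)] by (auto simp: horn_def intro: less_SucI)
    then show ?thesis using z by (simp add: WJ_def)
  qed
  have ends: "t @ [0] \<in> W0" "t @ [1] \<in> W1" if "t \<in> cube n" for t
    using that n by (auto simp: W0_def W1_def horn_def snoc_mem_cube cube_length nth_append intro!: exI[of _ n])
  have "pair_homotopy R n k E {e \<in> E. p e = b\<^sub>0} e\<^sub>0 G"
    unfolding pair_homotopy_def
  proof (intro conjI ballI impI)
    show "dmap R (n + 1) (cube (n + 1)) k G" "definable R k E"
      using G(1) by (auto simp: definable_map_iff)
    fix z :: "'a list" assume z: "z \<in> cube (n + 1)"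
    show "G z \<in> E" by (rule GE[OF z])
    show "G z \<in> {e \<in> E. p e = b\<^sub>0}" if "take n z \<in> cube_face n"
      using Hd(4)[OF z that] GE[OF z] G(2)[OF z] by simp
    show "G z = e\<^sub>0" if "take n z \<in> cube_J n"
      using mem_WJ[OF z that] G(3) \<psi>J sub by auto
  qed
  moreover have "G (t @ [0]) = f t" if "t \<in> cube n" for t
    using G(3)[of "t @ [0]"] \<psi>[OF ends(1)[OF that]] ends(1)[OF that] sub(1) cube_length[OF that] by auto
  moreover have "G (t @ [1]) = g t" if "t \<in> cube n" for t
    using G(3)[of "t @ [1]"] \<psi>1[OF ends(2)[OF that]] ends(2)[OF that] sub(2) cube_length[OF that] by auto
  ultimately show ?thesis unfolding homotopy_rel_iff[OF n] by blast
qed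

lemma lift_map:
  assumes n: "0 < n" and p: "definable_Serre_fibration R k E l B p"
    and e0: "e\<^sub>0 \<in> E" "p e\<^sub>0 = b\<^sub>0" and g: "g \<in> rel_maps R n l B {b\<^sub>0} b\<^sub>0"
  obtains G where "G \<in> rel_maps R n k E {e \<in> E. p e = b\<^sub>0} e\<^sub>0" "\<And>t. t \<in> cube n \<Longrightarrow> p (G t) = g t"
proof -
  let ?j = "n - 1"
  have j: "?j < n" using n by simp
  have E: "definable R k E"
    using p by (simp add: definable_Serre_fibration_def definable_map_def)
  have gd: "definable_map R n (cube n) l B g" "\<And>t. t \<in> cube_face n \<Longrightarrow> g t = b\<^sub>0" "\<And>t. t \<in> cube_J n \<Longrightarrow> g t = b\<^sub>0"
    using g unfolding rel_maps_iff[OF n] by auto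
  have "dmap R n (horn n ?j) k (\<lambda>_. e\<^sub>0)"
    using dmap_const[OF definable_horn[OF j], of R e\<^sub>0] definable_length[OF E e0(1)] by simp
  from horn_lifting[OF p j gd(1) this] obtain G where
    G: "definable_map R n (cube n) k E G" "\<And>x. x \<in> cube n \<Longrightarrow> p (G x) = g x"
      "\<And>x. x \<in> horn n ?j \<Longrightarrow> G x = e\<^sub>0"
    using e0 gd(3) unfolding cube_J_eq[OF n] by auto
  have "G t \<in> E \<and> p (G t) = b\<^sub>0" if "t \<in> cube_face n" for t
    using that G(1,2) gd(2) cube_face_subset_cube unfolding definable_map_iff by (metis image_subset_iff subsetD)
  then have "G \<in> rel_maps R n k E {e \<in> E. p e = b\<^sub>0} e\<^sub>0"
    unfolding rel_maps_iff[OF n] cube_J_eq[OF n] using G by blast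
  with G(2) show thesis by (rule that[rotated])
qed

section \<open>Passage to homotopy classes\<close>

lemma compose_homotopy_rel:
  assumes n: "0 < n" and p: "definable_map R k E l B p" and e0: "p e\<^sub>0 = b\<^sub>0"
    and fg: "(f, g) \<in> htp R n k E {e \<in> E. p e = b\<^sub>0} e\<^sub>0"
  shows "(p \<circ> f, p \<circ> g) \<in> htp R n l B {b\<^sub>0} b\<^sub>0"
proof -
  obtain H where H: "pair_homotopy R n k E {e \<in> E. p e = b\<^sub>0} e\<^sub>0 H"
    and ends: "\<forall>t\<in>cube n. H (t @ [0]) = f t" "\<forall>t\<in>cube n. H (t @ [1]) = g t"
    using fg unfolding homotopy_rel_iff[OF n] by blast
  note Hd = pair_homotopyD[OF H]
  have pd: "dmap R k E l p" "definable R l B" "p ` E \<subseteq> B" using p by (auto simp: definable_map_iff)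
  have "pair_homotopy R n l B {b\<^sub>0} b\<^sub>0 (\<lambda>z. p (H z))"
    unfolding pair_homotopy_def
    using dmap_compose[OF Hd(1) pd(1) Hd(3)] pd(2,3) Hd(3-5) e0 by blast
  with ends show ?thesis
    unfolding homotopy_rel_iff[OF n] by (intro exI[of _ "\<lambda>z. p (H z)"]) simp
qed

text \<open>\<open>induced_map\<close> is a union over representatives; composing homotopies with p
  shows that every representative contributes the same class.\<close>

lemma induced_map_class:
  assumes n: "0 < n" and p: "definable_map R k E l B p" and e0: "p e\<^sub>0 = b\<^sub>0"
    and f: "f \<in> rel_maps R n k E {e \<in> E. p e = b\<^sub>0} e\<^sub>0"
  shows "induced_map R n l B b\<^sub>0 p (htp R n k E {e \<in> E. p e = b\<^sub>0} e\<^sub>0 `` {f}) =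
    htp R n l B {b\<^sub>0} b\<^sub>0 `` {p \<circ> f}"
proof -
  have "congruent (htp R n k E {e \<in> E. p e = b\<^sub>0} e\<^sub>0) (\<lambda>f. htp R n l B {b\<^sub>0} b\<^sub>0 `` {p \<circ> f})"
    unfolding congruent_def
    using compose_homotopy_rel[OF n p e0] equiv_class_eq[OF equiv_homotopy_rel[OF n]] by blast
  from UN_equiv_class[OF equiv_homotopy_rel[OF n] this f] show ?thesis
    by (simp add: induced_map_def abs_maps_eq_rel_maps[OF n])
qed

text \<open>An equality of functions everywhere, as p acts after the choice of the half.
  Multiplicativity therefore holds for representatives, with no homotopy involved.\<close>

lemma comp_concat_maps: "p \<circ> concat_maps f g = concat_maps (p \<circ> f) (p \<circ> g)"
  by (auto simp: concat_maps_def)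

lemma comp_mem_rel_maps:
  assumes n: "0 < n" and p: "definable_map R k E l B p" and e0: "p e\<^sub>0 = b\<^sub>0"
    and f: "f \<in> rel_maps R n k E {e \<in> E. p e = b\<^sub>0} e\<^sub>0"
  shows "p \<circ> f \<in> rel_maps R n l B {b\<^sub>0} b\<^sub>0"
proof -
  have "(p \<circ> f, p \<circ> f) \<in> htp R n l B {b\<^sub>0} b\<^sub>0"
    by (rule compose_homotopy_rel[OF n p e0]) (rule homotopy_rel_if_eq_on_cube[OF n f refl])
  then show ?thesis by (simp add: homotopy_rel_def)
qed

lemma bij_betw_induced_map:
  assumes n: "0 < n" and p: "definable_Serre_fibration R k E l B p"
    and e0: "e\<^sub>0 \<in> E" "p e\<^sub>0 = b\<^sub>0"
  shows "bij_betw (induced_map R n l B b\<^sub>0 p)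
    (carrier (rel_pi R n k E {e \<in> E. p e = b\<^sub>0} e\<^sub>0)) (carrier (abs_pi R n l B b\<^sub>0))"
proof -
  let ?F = "{e \<in> E. p e = b\<^sub>0}"
  let ?M = "rel_maps R n k E ?F e\<^sub>0" and ?N = "rel_maps R n l B {b\<^sub>0} b\<^sub>0"
  let ?r = "htp R n k E ?F e\<^sub>0" and ?s = "htp R n l B {b\<^sub>0} b\<^sub>0"
  have pm: "definable_map R k E l B p" using p by (simp add: definable_Serre_fibration_def)
  note ind = induced_map_class[OF n pm e0(2)] and er = equiv_homotopy_rel[OF n]
  have "inj_on (induced_map R n l B b\<^sub>0 p) (?M // ?r)"
  proof (rule inj_onI)
    fix c d assume "c \<in> ?M // ?r" "d \<in> ?M // ?r" and eq: "induced_map R n l B b\<^sub>0 p c = induced_map R n l B b\<^sub>0 p d"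
    then obtain f g where f: "f \<in> ?M" "c = ?r `` {f}" and g: "g \<in> ?M" "d = ?r `` {g}"
      by (auto elim!: quotientE)
    have "(p \<circ> f, p \<circ> g) \<in> ?s"
      using eq unfolding f(2) g(2) ind[OF f(1)] ind[OF g(1)]
      by (rule eq_equiv_class[OF _ er comp_mem_rel_maps[OF n pm e0(2) g(1)]])
    from lift_homotopy[OF n p e0(2) f(1) g(1) this] show "c = d"
      unfolding f(2) g(2) by (rule equiv_class_eq[OF er])
  qed
  moreover have "induced_map R n l B b\<^sub>0 p ` (?M // ?r) = ?N // ?s"
  proof
    show "induced_map R n l B b\<^sub>0 p ` (?M // ?r) \<subseteq> ?N // ?s"
    proof (rule image_subsetI)
      fix c assume "c \<in> ?M // ?r"
      then obtain f where f: "f \<in> ?M" "c = ?r `` {f}" by (auto elim!: quotientE)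
      show "induced_map R n l B b\<^sub>0 p c \<in> ?N // ?s"
        unfolding f(2) ind[OF f(1)] by (rule quotientI) (rule comp_mem_rel_maps[OF n pm e0(2) f(1)])
    qed
    show "?N // ?s \<subseteq> induced_map R n l B b\<^sub>0 p ` (?M // ?r)"
    proof
      fix d assume "d \<in> ?N // ?s"
      then obtain g where g: "g \<in> ?N" "d = ?s `` {g}" by (auto elim!: quotientE)
      obtain G where G: "G \<in> ?M" "\<And>t. t \<in> cube n \<Longrightarrow> p (G t) = g t"
        using lift_map[OF n p e0 g(1)] by blast
      \<comment> \<open>The lift satisfies its equation only on the cube, so the two maps are
        homotopic but possibly different as functions.\<close>
      have "(p \<circ> G, g) \<in> ?s"
        using G by (intro homotopy_rel_if_eq_on_cube[OF n] comp_mem_rel_maps[OF n pm e0(2)]) auto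
      then have "d = induced_map R n l B b\<^sub>0 p (?r `` {G})"
        unfolding g(2) ind[OF G(1)] by (rule equiv_class_eq[OF er, symmetric])
      then show "d \<in> induced_map R n l B b\<^sub>0 p ` (?M // ?r)"
        using quotientI[OF G(1)] by blast
    qed
  qed
  ultimately show ?thesis
    by (simp add: bij_betw_def abs_pi_eq_rel_pi[OF n] rel_pi_carrier)
qed

lemma induced_map_hom:
  assumes n: "2 \<le> n" and p: "definable_Serre_fibration R k E l B p"
    and e0: "e\<^sub>0 \<in> E" "p e\<^sub>0 = b\<^sub>0"
  shows "induced_map R n l B b\<^sub>0 p \<in> hom (rel_pi R n k E {e \<in> E. p e = b\<^sub>0} e\<^sub>0) (abs_pi R n l B b\<^sub>0)"
proof (rule homI)
  let ?F = "{e \<in> E. p e = b\<^sub>0}"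
  let ?M = "rel_maps R n k E ?F e\<^sub>0"
  let ?r = "htp R n k E ?F e\<^sub>0"
  let ?P = "rel_pi R n k E ?F e\<^sub>0" and ?p = "induced_map R n l B b\<^sub>0 p"
  have n0: "0 < n" using n by simp
  have pm: "definable_map R k E l B p" using p by (simp add: definable_Serre_fibration_def)
  note ind = induced_map_class[OF n0 pm e0(2)] and comp = comp_mem_rel_maps[OF n0 pm e0(2)]
  show "?p c \<in> carrier (abs_pi R n l B b\<^sub>0)" if "c \<in> carrier ?P" for c
    using bij_betw_induced_map[OF n0 p e0] that by (rule bij_betw_apply)
  fix c d assume "c \<in> carrier ?P" "d \<in> carrier ?P"
  then obtain f g where f: "f \<in> ?M" "c = ?r `` {f}" and g: "g \<in> ?M" "d = ?r `` {g}"
    unfolding rel_pi_carrier by (auto elim!: quotientE)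
  show "?p (c \<otimes>\<^bsub>?P\<^esub> d) = ?p c \<otimes>\<^bsub>abs_pi R n l B b\<^sub>0\<^esub> ?p d"
    unfolding abs_pi_eq_rel_pi[OF n0] f(2) g(2) rel_pi_mult[OF n f(1) g(1)] ind[OF f(1)] ind[OF g(1)]
      rel_pi_mult[OF n comp[OF f(1)] comp[OF g(1)]] ind[OF concat_maps_mem_rel_maps[OF n f(1) g(1)]]
      comp_concat_maps ..
qed

theorem theorem4p9:
  fixes R :: "('a::linordered_field, 'f, 'r) expansion"
    and k l :: nat
    and E B F :: "'a list set"
    and p :: "'a list \<Rightarrow> 'a list"
    and b\<^sub>0 e\<^sub>0 :: "'a list"
  assumes "real_closed_field TYPE('a)"
    and "o_minimal R"
    and "definable_Serre_fibration R k E l B p"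
    and "b\<^sub>0 \<in> B"
    and "F = {e \<in> E. p e = b\<^sub>0}"
    and "e\<^sub>0 \<in> F"
  shows "bij_betw (induced_map R 1 l B b\<^sub>0 p)
           (carrier (rel_pi R 1 k E F e\<^sub>0)) (carrier (abs_pi R 1 l B b\<^sub>0)) \<and>
         (\<forall>n\<ge>2. induced_map R n l B b\<^sub>0 p \<in> iso (rel_pi R n k E F e\<^sub>0) (abs_pi R n l B b\<^sub>0))"
proof -
  have e0: "e\<^sub>0 \<in> E" "p e\<^sub>0 = b\<^sub>0" using assms(5,6) by auto
  note bij = bij_betw_induced_map[OF _ assms(3) e0, folded assms(5)]
    and hom = induced_map_hom[OF _ assms(3) e0, folded assms(5)]
  \<comment> \<open>Bijectivity is available in every positive dimension; compatibility with
    products joins it from dimension 2 on.\<close>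
  show ?thesis using bij[of 1] bij hom by (auto simp: iso_def simp del: One_nat_def)
qed

end
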